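(* Consider the problem $$\text{maximize}\ \ \mathbb{E}_v\Big[(p-\hat r(v))\,\Phi\Big(\frac{v-c}{\sigma_\epsilon}\Big)\Big]$$ over $c\in\mathbb{R}$ and continuous, piecewise continuously differentiable functions $\hat r:\mathbb{R}\to[0,p]$ satisfying the rate of change constraint $\big|\frac{d}{dv}\hat r(v)\big|\le\frac1\tau$, subject to $c+\mathbb{E}_{v|v_i=c}[\hat r(v)]=p$. The optimal reward program $\hat r^*_{RC}$ is of the form $$\hat r^*_{RC}(v)=\begin{cases}p, & v<v_L,\\ p-\frac1\tau(v-v_L), & v_L\le v<v_H,\\ 0, & v_H\le v,\end{cases}$$ where $(c,v_L,v_H)$ is the solution of $$\frac{\displaystyle\int_{v_L}^{v_H}\Phi\Big(\frac{w-c}{\sigma_\epsilon}\Big)\frac{1}{\sigma_\theta}\phi\Big(\frac{\theta-w}{\sigma_\theta}\Big)dw}{\Phi\big(\frac{v_H-\mu_c}{\sigma_v}\big)-\Phi\big(\frac{v_L-\mu_c}{\sigma_v}\big)}=\frac{c\,\frac1\sigma\phi\big(\frac{\theta-c}{\sigma}\big)}{1+\Phi\big(\frac{v_L-\mu_c}{\sigma_v}\big)-\Phi\big(\frac{v_H-\mu_c}{\sigma_v}\big)},$$ $$v_H-v_L=\tau p,$$ $$p=c+\frac{\sigma_v}{\tau}\Big(\frac{v_H-\mu_c}{\sigma_v}\Phi\Big(\frac{v_H-\mu_c}{\sigma_v}\Big)-\frac{v_L-\mu_c}{\sigma_v}\Phi\Big(\frac{v_L-\mu_c}{\sigma_v}\Big)+\phi\Big(\frac{v_H-\mu_c}{\sigma_v}\Big)-\phi\Big(\frac{v_L-\mu_c}{\sigma_v}\Big)\Big),$$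 with $\mu_c=\tau c+(1-\tau)\theta$.
   Context: Parameters: $\theta\in\mathbb{R}$, $\sigma_\theta>0$, $\sigma_\epsilon>0$, $\sigma=\sqrt{\sigma_\theta^2+\sigma_\epsilon^2}$. $\Phi$ and $\phi$ are the CDF and PDF of the standard normal distribution. The quality $v$ of a product has prior $v\sim N(\theta,\sigma_\theta^2)$; $\mathbb{E}_v$ is expectation under this prior. Consumers have valuations $v_i=v+\epsilon_i$ with $\epsilon_i\sim N(0,\sigma_\epsilon^2)$ independent of $v$, so that $v\,|\,v_i\sim N(\tau v_i+(1-\tau)\theta,\sigma_v^2)$ with $\tau=\frac{\sigma_\theta^2}{\sigma_\epsilon^2+\sigma_\theta^2}$ and $\sigma_v=\frac{\sigma_\epsilon\sigma_\theta}{\sqrt{\sigma_\epsilon^2+\sigma_\theta^2}}$; $\mathbb{E}_{v|v_i}$ is expectation under this posterior. Standing assumption: the market price $p>0$ maximizes $p\mapsto p\,\Phi(\frac{\theta-p}{\sigma})$, i.e. it is the unique solution of $\frac{p}{\sigma}=\Phi(\frac{\theta-p}{\sigma})/\phi(\frac{\theta-p}{\sigma})$. $\hat r(v)$ is the rebate paid to each buyer when the realized quality is $v$; $c$ is the cutoff of the consumers' purchase strategy (buy iff $v_i>c$), the equality constraint says that a consumer with valuation $c$ is indifferent, and the objective is the seller's expected profit. The derivative bound is required wherever $\hat r$ is differentiable.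
   Formalization: "The solution" is read as "a solution": an optimum exists and every optimal (c, r) has the stated form with (c, v_L, v_H) solving the system; uniqueness is not claimed, as the system can have several solutions (e.g. σ=1, τ=0.58, θ=20). *)

theory Defs
  imports "HOL-Probability.Probability"
begin

abbreviation normal_distribution :: "real \<Rightarrow> real \<Rightarrow> real measure" where
  "normal_distribution \<mu> s \<equiv> density lborel (normal_density \<mu> s)"

abbreviation \<phi> :: "real \<Rightarrow> real" where
  "\<phi> \<equiv> std_normal_density"

abbreviation \<Phi> :: "real \<Rightarrow> real" where
  "\<Phi> \<equiv> cdf std_normal_distribution"

definition sigma_total :: "real \<Rightarrow> real \<Rightarrow> real" where
  "sigma_total \<sigma>\<^sub>\<theta> \<sigma>\<^sub>\<epsilon> = sqrt (\<sigma>\<^sub>\<theta>\<^sup>2 + \<sigma>\<^sub>\<epsilon>\<^sup>2)"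

definition tau :: "real \<Rightarrow> real \<Rightarrow> real" where
  "tau \<sigma>\<^sub>\<theta> \<sigma>\<^sub>\<epsilon> = \<sigma>\<^sub>\<theta>\<^sup>2 / (\<sigma>\<^sub>\<epsilon>\<^sup>2 + \<sigma>\<^sub>\<theta>\<^sup>2)"

definition sigma_post :: "real \<Rightarrow> real \<Rightarrow> real" where
  "sigma_post \<sigma>\<^sub>\<theta> \<sigma>\<^sub>\<epsilon> = \<sigma>\<^sub>\<epsilon> * \<sigma>\<^sub>\<theta> / sqrt (\<sigma>\<^sub>\<epsilon>\<^sup>2 + \<sigma>\<^sub>\<theta>\<^sup>2)"

definition mu_post :: "real \<Rightarrow> real \<Rightarrow> real \<Rightarrow> real \<Rightarrow> real" where
  "mu_post \<theta> \<sigma>\<^sub>\<theta> \<sigma>\<^sub>\<epsilon> x = tau \<sigma>\<^sub>\<theta> \<sigma>\<^sub>\<epsilon> * x + (1 - tau \<sigma>\<^sub>\<theta> \<sigma>\<^sub>\<epsilon>) * \<theta>"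

text \<open>
  The Bayesian posterior of \<open>v \<sim> N(\<theta>, \<sigma>\<^sub>\<theta>\<^sup>2)\<close> given \<open>v + \<epsilon> = x\<close>, where
  \<open>\<epsilon> \<sim> N(0, \<sigma>\<^sub>\<epsilon>\<^sup>2)\<close> is independent of \<open>v\<close>, in closed form.
\<close>

definition posterior :: "real \<Rightarrow> real \<Rightarrow> real \<Rightarrow> real \<Rightarrow> real measure" where
  "posterior \<theta> \<sigma>\<^sub>\<theta> \<sigma>\<^sub>\<epsilon> x =
     normal_distribution (mu_post \<theta> \<sigma>\<^sub>\<theta> \<sigma>\<^sub>\<epsilon> x) (sigma_post \<sigma>\<^sub>\<theta> \<sigma>\<^sub>\<epsilon>)"

definition market_price :: "real \<Rightarrow> real \<Rightarrow> real \<Rightarrow> real \<Rightarrow> bool" where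
  "market_price \<theta> \<sigma>\<^sub>\<theta> \<sigma>\<^sub>\<epsilon> p \<longleftrightarrow>
     is_arg_max (\<lambda>q. q * \<Phi> ((\<theta> - q) / sigma_total \<sigma>\<^sub>\<theta> \<sigma>\<^sub>\<epsilon>)) (\<lambda>q. 0 < q) p"

definition expected_profit ::
  "real \<Rightarrow> real \<Rightarrow> real \<Rightarrow> real \<Rightarrow> real \<Rightarrow> (real \<Rightarrow> real) \<Rightarrow> real" where
  "expected_profit \<theta> \<sigma>\<^sub>\<theta> \<sigma>\<^sub>\<epsilon> p c r =
     (LINT v|normal_distribution \<theta> \<sigma>\<^sub>\<theta>. (p - r v) * \<Phi> ((v - c) / \<sigma>\<^sub>\<epsilon>))"

text \<open>
  The exceptional points of a piecewise continuously differentiable function on the whole line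
  only need to be finite in number on each bounded interval.
\<close>

definition rate_constrained :: "real \<Rightarrow> real \<Rightarrow> (real \<Rightarrow> real) \<Rightarrow> bool" where
  "rate_constrained p L r \<longleftrightarrow>
     continuous_on UNIV r \<and>
     (\<forall>a b. r piecewise_C1_differentiable_on {a..b}) \<and>
     (\<forall>v. r v \<in> {0..p}) \<and>
     (\<forall>v. r differentiable (at v) \<longrightarrow> \<bar>deriv r v\<bar> \<le> L)"

definition feasible ::
  "real \<Rightarrow> real \<Rightarrow> real \<Rightarrow> real \<Rightarrow> real \<Rightarrow> (real \<Rightarrow> real) \<Rightarrow> bool" where
  "feasible \<theta> \<sigma>\<^sub>\<theta> \<sigma>\<^sub>\<epsilon> p c r \<longleftrightarrow>
     rate_constrained p (1 / tau \<sigma>\<^sub>\<theta> \<sigma>\<^sub>\<epsilon>) r \<and>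
     c + (LINT v|posterior \<theta> \<sigma>\<^sub>\<theta> \<sigma>\<^sub>\<epsilon> c. r v) = p"

definition optimal ::
  "real \<Rightarrow> real \<Rightarrow> real \<Rightarrow> real \<Rightarrow> real \<Rightarrow> (real \<Rightarrow> real) \<Rightarrow> bool" where
  "optimal \<theta> \<sigma>\<^sub>\<theta> \<sigma>\<^sub>\<epsilon> p c r \<longleftrightarrow>
     is_arg_max (\<lambda>(c, r). expected_profit \<theta> \<sigma>\<^sub>\<theta> \<sigma>\<^sub>\<epsilon> p c r)
       (\<lambda>(c, r). feasible \<theta> \<sigma>\<^sub>\<theta> \<sigma>\<^sub>\<epsilon> p c r) (c, r)"

definition rc_program :: "real \<Rightarrow> real \<Rightarrow> real \<Rightarrow> real \<Rightarrow> real \<Rightarrow> real" where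
  "rc_program t p v\<^sub>L v\<^sub>H v =
     (if v < v\<^sub>L then p else if v < v\<^sub>H then p - 1 / t * (v - v\<^sub>L) else 0)"

definition rc_system ::
  "real \<Rightarrow> real \<Rightarrow> real \<Rightarrow> real \<Rightarrow> real \<Rightarrow> real \<Rightarrow> real \<Rightarrow> bool" where
  "rc_system \<theta> \<sigma>\<^sub>\<theta> \<sigma>\<^sub>\<epsilon> p c v\<^sub>L v\<^sub>H \<longleftrightarrow>
     (let \<sigma> = sigma_total \<sigma>\<^sub>\<theta> \<sigma>\<^sub>\<epsilon>; \<tau> = tau \<sigma>\<^sub>\<theta> \<sigma>\<^sub>\<epsilon>; \<sigma>\<^sub>v = sigma_post \<sigma>\<^sub>\<theta> \<sigma>\<^sub>\<epsilon>;
          \<mu>\<^sub>c = mu_post \<theta> \<sigma>\<^sub>\<theta> \<sigma>\<^sub>\<epsilon> c;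
          x\<^sub>L = (v\<^sub>L - \<mu>\<^sub>c) / \<sigma>\<^sub>v; x\<^sub>H = (v\<^sub>H - \<mu>\<^sub>c) / \<sigma>\<^sub>v
      in (LBINT w=v\<^sub>L..v\<^sub>H. \<Phi> ((w - c) / \<sigma>\<^sub>\<epsilon>) * (1 / \<sigma>\<^sub>\<theta>) * \<phi> ((\<theta> - w) / \<sigma>\<^sub>\<theta>)) / (\<Phi> x\<^sub>H - \<Phi> x\<^sub>L)
           = c * (1 / \<sigma>) * \<phi> ((\<theta> - c) / \<sigma>) / (1 + \<Phi> x\<^sub>L - \<Phi> x\<^sub>H) \<and>
         v\<^sub>H - v\<^sub>L = \<tau> * p \<and>
         p = c + \<sigma>\<^sub>v / \<tau> * (x\<^sub>H * \<Phi> x\<^sub>H - x\<^sub>L * \<Phi> x\<^sub>L + \<phi> x\<^sub>H - \<phi> x\<^sub>L))"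

end

theory Submission
  imports Defs
begin

text \<open>
  For a fixed cutoff \<open>x\<close>, the profit weighs the rebate at \<open>v\<close> by \<open>\<Phi> ((v - x) / \<sigma>\<^sub>\<epsilon>)\<close> and the
  indifference condition weighs it by \<open>\<phi> ((v - x) / \<sigma>\<^sub>\<epsilon>)\<close>, both against the prior (Bayes' rule). The
  ratio \<open>\<Phi> / \<phi>\<close> is strictly increasing, so rebates should sit at low qualities. Any admissible \<open>r\<close>
  crosses the ramp of slope \<open>- 1 / \<tau>\<close> with the same posterior mean once, from below, and therefore
  earns strictly less than the ramp unless it equals it.

  The ramps satisfying the indifference condition form a curve parametrised by
  \<open>m = \<mu>\<^sub>c - v\<^sub>L\<close>, since their posterior mean \<open>H m\<close> depends on \<open>m\<close> only and so \<open>c = p - H m\<close>.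
  The profit \<open>J m\<close> along the curve tends to \<open>0\<close> at \<open>-\<infinity>\<close> and to the profit without rebates
  at \<open>\<infinity>\<close>; the latter is exceeded for large \<open>m\<close>, because a rebate paid only at very low
  qualities costs \<open>o (H m)\<close> while it lowers the cutoff by \<open>H m\<close>. Hence \<open>J\<close> attains its
  maximum, and \<open>J' = 0\<close> is the first equation of the system.
\<close>

subsection \<open>The standard normal distribution\<close>

lemma has_real_derivative_phi: "(\<phi> has_real_derivative - x * \<phi> x) (at x)"
proof -
  have "((\<lambda>x. (1 / sqrt (2 * pi)) * exp (- x\<^sup>2 / 2)) has_real_derivative
      - x * ((1 / sqrt (2 * pi)) * exp (- x\<^sup>2 / 2))) (at x)"
    by (rule derivative_eq_intros refl | simp)+
  then show ?thesis
    by (simp add: std_normal_density_def[abs_def])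
qed

lemma isCont_phi: "isCont \<phi> x"
  using has_real_derivative_phi by (rule DERIV_isCont)

lemma phi_pos: "0 < \<phi> x"
  by (simp add: normal_density_pos)

lemma phi_le_1: "\<phi> x \<le> 1"
proof -
  have "1 \<le> sqrt (2 * pi)" using pi_gt3 by simp
  then have "\<phi> x \<le> 1 * exp 0"
    unfolding std_normal_density_def
    by (intro mult_mono) (auto simp: field_simps)
  then show ?thesis by simp
qed

lemma phi_mono_abs: "\<bar>x\<bar> \<le> \<bar>y\<bar> \<Longrightarrow> \<phi> y \<le> \<phi> x"
  unfolding std_normal_density_def by (auto simp: abs_le_square_iff divide_right_mono)

lemma phi_tendsto_at_bot: "(\<phi> \<longlongrightarrow> 0) at_bot"
proof -
  have "LIM x at_bot. (x::real)\<^sup>2 / 2 :> at_top"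
    using filterlim_tendsto_pos_mult_at_top[OF tendsto_const _ filterlim_pow_at_bot_even[OF _ filterlim_ident, of 2], of "1/2"]
    by simp
  then have "((\<lambda>x::real. exp (- (x\<^sup>2 / 2))) \<longlongrightarrow> 0) at_bot"
    by (intro filterlim_compose[OF exp_at_bot]) (simp add: filterlim_uminus_at_bot)
  then have "((\<lambda>x. (1 / sqrt (2 * pi)) * exp (- (x\<^sup>2 / 2))) \<longlongrightarrow> (1 / sqrt (2 * pi)) * 0) at_bot"
    by (rule tendsto_mult[OF tendsto_const])
  then show ?thesis
    by (simp add: std_normal_density_def[abs_def])
qed

lemma Phi_diff:
  assumes "a \<le> b"
  shows "\<Phi> b - \<Phi> a = integral {a..b} \<phi>"
proof (cases "a = b")
  case False
  interpret real_distribution std_normal_distribution by (rule real_dist_normal_dist)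
  have int: "set_integrable lborel {a<..b} \<phi>"
    unfolding set_integrable_def by (intro integrable_mult_indicator) auto
  have "\<Phi> b - \<Phi> a = measure std_normal_distribution {a<..b}"
    using False assms by (simp add: cdf_diff_eq)
  also have "\<dots> = (LINT x : {a<..b} | lborel. \<phi> x)"
    using integral_density[of "indicator {a<..b} :: real \<Rightarrow> real" lborel \<phi>]
    by (simp add: set_lebesgue_integral_def mult.commute)
  also have "\<dots> = integral {a<..b} \<phi>"
    using int by (rule set_borel_integral_eq_integral)
  also have "\<dots> = integral {a..b} \<phi>"
    by (rule integral_subset_negligible) (auto intro: negligible_subset[of "{a}"])
  finally show ?thesis .
qed auto

lemma has_real_derivative_Phi: "(\<Phi> has_real_derivative \<phi> x) (at x)"
proof -
  \<comment> \<open>The base point \<open>x - 1\<close> lies strictly to the left of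
    \<open>x\<close>, so \<open>Phi_diff\<close> expresses \<open>\<Phi> u\<close> through this
    integral for all \<open>u\<close> near \<open>x\<close>.\<close>
  have "((\<lambda>u. integral {x - 1..u} \<phi>) has_real_derivative \<phi> x) (at x within {x - 1..x + 1})"
    by (rule integral_has_real_derivative)
       (auto intro!: continuous_at_imp_continuous_on isCont_phi)
  then have "((\<lambda>u. integral {x - 1..u} \<phi>) has_real_derivative \<phi> x) (at x)"
    by (subst (asm) at_within_interior) auto
  then have "((\<lambda>u. \<Phi> (x - 1) + integral {x - 1..u} \<phi>) has_real_derivative \<phi> x) (at x)"
    by (auto intro!: derivative_eq_intros)
  then show ?thesis
    by (rule has_field_derivative_transform_within_open[where S="{x - 1<..}"])
       (auto simp: Phi_diff[symmetric])
qed

lemma Phi_strict_mono: "x < y \<Longrightarrow> \<Phi> x < \<Phi> y"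
  by (rule DERIV_pos_imp_increasing) (use has_real_derivative_Phi phi_pos in blast)+

lemma Phi_nonneg: "0 \<le> \<Phi> x"
  and Phi_le_1: "\<Phi> x \<le> 1"
proof -
  interpret real_distribution std_normal_distribution by (rule real_dist_normal_dist)
  show "0 \<le> \<Phi> x" "\<Phi> x \<le> 1" by (auto simp: cdf_nonneg cdf_bounded_prob)
qed

lemma Phi_pos: "0 < \<Phi> x"
  using Phi_nonneg[of "x - 1"] Phi_strict_mono[of "x - 1" x] by simp

lemma isCont_Phi: "isCont \<Phi> x"
  using has_real_derivative_Phi by (rule DERIV_isCont)

lemma Phi_lipschitz: "\<bar>\<Phi> x - \<Phi> y\<bar> \<le> \<bar>x - y\<bar>"
proof -
  have "norm (\<Phi> x - \<Phi> y) \<le> 1 * norm (x - y)"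
    by (rule field_differentiable_bound[of UNIV \<Phi> \<phi>])
       (auto simp: has_real_derivative_Phi phi_le_1)
  then show ?thesis by simp
qed

text \<open>\<open>\<Psi> x\<close> is the expectation of the positive part of \<open>x - Z\<close> for standard normal \<open>Z\<close>.\<close>

definition \<Psi> :: "real \<Rightarrow> real" where
  "\<Psi> x = x * \<Phi> x + \<phi> x"

lemma has_real_derivative_Psi: "(\<Psi> has_real_derivative \<Phi> x) (at x)"
  unfolding \<Psi>_def[abs_def]
  by (rule derivative_eq_intros has_real_derivative_Phi has_real_derivative_phi refl | simp)+

lemma Phi_eq_integral: "\<Phi> x = (LINT z|lborel. indicator {..x} z * \<phi> z)"
proof -
  interpret real_distribution std_normal_distribution by (rule real_dist_normal_dist)
  show ?thesis
    using integral_density[of "indicator {..x} :: real \<Rightarrow> real" lborel \<phi>]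
    by (simp add: cdf_def2 mult.commute)
qed

lemma integrable_phi_moment: "integrable lborel (\<lambda>z. z * \<phi> z)"
  using integrable_std_normal_moment[of 1] by (simp add: mult.commute)

text \<open>Since \<open>\<phi>\<close> has derivative \<open>- z * \<phi> z\<close>, an
  antiderivative of the integrand is \<open>- \<phi>\<close>, and it vanishes at minus
  infinity.\<close>

lemma partial_moment_phi: "(LINT z|lborel. indicator {..x} z * (z * \<phi> z)) = - \<phi> x"
proof -
  have "(LBINT z=-\<infinity>..ereal x. z * \<phi> z) = - \<phi> x - 0"
  proof (rule interval_integral_FTC_integrable[where F="\<lambda>z. - \<phi> z"])
    show "((\<lambda>z. - \<phi> z) has_vector_derivative z * \<phi> z) (at z)" for z
      unfolding has_real_derivative_iff_has_vector_derivative[symmetric]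
      by (rule derivative_eq_intros has_real_derivative_phi refl | simp)+
    show "isCont (\<lambda>z. z * \<phi> z) z" for z
      by (intro continuous_intros isCont_phi)
    show "set_integrable lborel (einterval (-\<infinity>) (ereal x)) (\<lambda>z. z * \<phi> z)"
      unfolding set_integrable_def
      by (intro integrable_mult_indicator integrable_phi_moment) simp
    show "(((\<lambda>z. - \<phi> z) \<circ> real_of_ereal) \<longlongrightarrow> 0) (at_right (- \<infinity>))"
      using tendsto_minus[OF phi_tendsto_at_bot] by (simp add: ereal_tendsto_simps)
    show "(((\<lambda>z. - \<phi> z) \<circ> real_of_ereal) \<longlongrightarrow> - \<phi> x) (at_left (ereal x))"
      unfolding ereal_tendsto_simps
      by (rule tendsto_minus, rule tendsto_mono[OF at_le isCont_phi[unfolded isCont_def]]) simp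
  qed simp
  also have "(LBINT z=-\<infinity>..ereal x. z * \<phi> z) = (LINT z:{..<x}|lborel. z * \<phi> z)"
    by (simp add: interval_lebesgue_integral_def einterval_def lessThan_def)
  also have "\<dots> = (LINT z:{..x}|lborel. z * \<phi> z)"
    by (rule set_integral_discrete_difference[where X="{x}"]) auto
  finally show ?thesis
    by (simp add: set_lebesgue_integral_def)
qed

lemma integrable_pos_part_phi: "integrable lborel (\<lambda>z. max 0 (x - z) * \<phi> z)"
proof (rule Bochner_Integration.integrable_bound)
  show "integrable lborel (\<lambda>z. \<bar>x\<bar> * \<phi> z + \<bar>z * \<phi> z\<bar>)"
    by (intro Bochner_Integration.integrable_add integrable_abs integrable_phi_moment integrable_mult_right) auto
  have "max 0 (x - z) * \<phi> z \<le> (\<bar>x\<bar> + \<bar>z\<bar>) * \<phi> z" for z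
    by (rule mult_right_mono) auto
  then show "AE z in lborel. norm (max 0 (x - z) * \<phi> z) \<le> norm (\<bar>x\<bar> * \<phi> z + \<bar>z * \<phi> z\<bar>)"
    by (simp add: abs_mult algebra_simps)
qed simp

lemma integral_pos_part_phi: "(LINT z|lborel. max 0 (x - z) * \<phi> z) = \<Psi> x"
proof -
  have "(LINT z|lborel. max 0 (x - z) * \<phi> z) =
      (LINT z|lborel. x * (indicator {..x} z * \<phi> z) - indicator {..x} z * (z * \<phi> z))"
    by (rule Bochner_Integration.integral_cong) (auto simp: indicator_def algebra_simps max_def)
  also have "\<dots> = x * \<Phi> x - (- \<phi> x)"
    unfolding Phi_eq_integral partial_moment_phi[symmetric]
    using integrable_mult_indicator[of "{..x}" lborel \<phi>]
      integrable_mult_indicator[OF _ integrable_phi_moment, of "{..x}"]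
    by (subst Bochner_Integration.integral_diff) auto
  finally show ?thesis by (simp add: \<Psi>_def)
qed

text \<open>The integral representation gives only nonnegativity. Strictness comes from applying it
  at \<open>x - 1\<close> and using that \<Psi> has the positive derivative \<Phi>.\<close>

lemma Psi_pos: "0 < \<Psi> x"
proof -
  have "0 \<le> \<Psi> (x - 1)"
    unfolding integral_pos_part_phi[symmetric] by (rule Bochner_Integration.integral_nonneg) simp
  also have "\<Psi> (x - 1) < \<Psi> x"
    by (rule DERIV_pos_imp_increasing[of "x - 1"]) (use has_real_derivative_Psi Phi_pos in \<open>auto intro!: exI\<close>)
  finally show ?thesis .
qed

text \<open>The derivative of the ratio is \<open>\<Psi> / \<phi>\<close>, so positivity of \<Psi>
  is exactly what is required. Equivalently, \<Phi> is strictly log-concave.\<close>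

lemma mills_strict_mono:
  assumes "x < y"
  shows "\<Phi> x / \<phi> x < \<Phi> y / \<phi> y"
proof (rule DERIV_pos_imp_increasing[OF assms])
  fix z
  have "((\<lambda>z. \<Phi> z / \<phi> z) has_real_derivative \<Psi> z / \<phi> z) (at z)"
    using phi_pos[of z] unfolding \<Psi>_def
    by (auto intro!: derivative_eq_intros has_real_derivative_Phi has_real_derivative_phi simp: field_simps)
  then show "\<exists>d. ((\<lambda>z. \<Phi> z / \<phi> z) has_real_derivative d) (at z) \<and> 0 < d"
    using Psi_pos phi_pos by (meson divide_pos_pos)
qed

text \<open>This is the Mills bound \<open>- x * \<Phi> x \<le> \<phi> x\<close>, which is
  positivity of \<Psi>. It makes a rebate paid far below the cutoff cheap relative to its effect on
  the indifference condition.\<close>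

lemma Phi_le_small_phi:
  assumes "0 < e" "x \<le> - 1 / e"
  shows "\<Phi> x \<le> e * \<phi> x"
proof -
  have "- x * \<Phi> x \<le> \<phi> x"
    using Psi_pos[of x] by (simp add: \<Psi>_def)
  moreover have "1 / e * \<Phi> x \<le> - x * \<Phi> x"
    using assms Phi_nonneg by (intro mult_right_mono) auto
  ultimately have "1 / e * \<Phi> x \<le> \<phi> x"
    by simp
  then show ?thesis
    using assms(1) by (simp add: field_simps)
qed

lemma measurable_Phi [measurable]: "\<Phi> \<in> borel_measurable borel"
  by (rule borel_measurable_continuous_onI) (auto intro!: continuous_at_imp_continuous_on isCont_Phi)

lemma Phi_increment_lower_bound:
  assumes "a \<le> b" "\<bar>a\<bar> \<le> k" "\<bar>b\<bar> \<le> k"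
  shows "(b - a) * \<phi> k \<le> \<Phi> b - \<Phi> a"
proof (cases "a = b")
  case False
  then obtain z where z: "a < z" "z < b" "\<Phi> b - \<Phi> a = (b - a) * \<phi> z"
    using MVT2[of a b \<Phi> \<phi>] has_real_derivative_Phi assms(1) by force
  moreover have "\<phi> k \<le> \<phi> z"
    using z assms by (intro phi_mono_abs) auto
  ultimately show ?thesis
    using assms(1) by (simp add: mult_left_mono)
qed simp

subsection \<open>Real analysis\<close>

text \<open>Dominated convergence of the difference quotients: the common Lipschitz constant
  dominates them and is integrable on a finite measure space. Differentiability is asked only almost
  everywhere, to allow for the two kinks of a ramp.\<close>

lemma has_real_derivative_integral_lipschitz:
  fixes h :: "real \<Rightarrow> 'a \<Rightarrow> real"
  assumes "finite_measure M"
    and int: "\<And>t. integrable M (h t)"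
    and lip: "\<And>s t x. \<bar>h s x - h t x\<bar> \<le> C * \<bar>s - t\<bar>"
    and der: "AE x in M. ((\<lambda>t. h t x) has_real_derivative d x) (at t\<^sub>0)"
    and meas: "d \<in> borel_measurable M"
  shows "((\<lambda>t. LINT x|M. h t x) has_real_derivative (LINT x|M. d x)) (at t\<^sub>0)"
  unfolding has_field_derivative_iff tendsto_at_iff_sequentially
proof (intro allI impI)
  interpret finite_measure M by fact
  fix X assume X: "\<forall>i. X i \<in> UNIV - {t\<^sub>0}" "X \<longlonglongrightarrow> t\<^sub>0"
  have "(\<lambda>i. LINT x|M. (h (X i) x - h t\<^sub>0 x) / (X i - t\<^sub>0)) \<longlonglongrightarrow> (LINT x|M. d x)"
  proof (rule integral_dominated_convergence[where w="\<lambda>_. C"])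
    show "AE x in M. (\<lambda>i. (h (X i) x - h t\<^sub>0 x) / (X i - t\<^sub>0)) \<longlonglongrightarrow> d x"
      using der
    proof eventually_elim
      case (elim x)
      then show ?case
        using X unfolding has_field_derivative_iff tendsto_at_iff_sequentially
        by (auto simp: comp_def)
    qed
    show "AE x in M. norm ((h (X i) x - h t\<^sub>0 x) / (X i - t\<^sub>0)) \<le> C" for i
      using X(1) lip[of "X i" _ t\<^sub>0] by (auto simp: divide_simps)
    show "(\<lambda>x. (h (X i) x - h t\<^sub>0 x) / (X i - t\<^sub>0)) \<in> borel_measurable M" for i
      using borel_measurable_integrable[OF int] by measurable
  qed (use meas in auto)
  then show "((\<lambda>y. ((LINT x|M. h y x) - (LINT x|M. h t\<^sub>0 x)) / (y - t\<^sub>0)) \<circ> X) \<longlonglongrightarrow> (LINT x|M. d x)"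
    using int by (simp add: comp_def)
qed

text \<open>As \<open>f t\<close> exceeds both limits, \<open>f\<close> stays below
  \<open>f t\<close> outside a compact interval around \<open>t\<close>, so the maximum on that
  interval is global.\<close>

lemma continuous_attains_sup_real:
  fixes f :: "real \<Rightarrow> real"
  assumes cont: "continuous_on UNIV f"
    and bot: "(f \<longlongrightarrow> l) at_bot" and top: "(f \<longlongrightarrow> u) at_top"
    and "l < f t" "u < f t"
  shows "\<exists>m. \<forall>x. f x \<le> f m"
proof -
  obtain a where a: "\<And>x. x \<le> a \<Longrightarrow> f x < f t"
    using order_tendstoD(2)[OF bot \<open>l < f t\<close>] by (auto simp: eventually_at_bot_linorder)
  obtain b where b: "\<And>x. b \<le> x \<Longrightarrow> f x < f t"
    using order_tendstoD(2)[OF top \<open>u < f t\<close>] by (auto simp: eventually_at_top_linorder)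
  have t: "t \<in> {a..b}" using a[of t] b[of t] by force
  then obtain m where m: "\<forall>x\<in>{a..b}. f x \<le> f m"
    using continuous_attains_sup[of "{a..b}" f] continuous_on_subset[OF cont] by auto
  have "f x \<le> f m" for x
  proof (cases "x \<in> {a..b}")
    case False
    then have "f x < f t" using a[of x] b[of x] by (cases "x \<le> a") auto
    also have "f t \<le> f m" using m t by blast
    finally show ?thesis by simp
  qed (use m in blast)
  then show ?thesis by blast
qed

text \<open>The set where \<open>f\<close> does not vanish is open, and a nonempty open set is not a
  null set.\<close>

lemma continuous_AE_zero:
  fixes f :: "real \<Rightarrow> real"
  assumes "continuous_on UNIV f" "AE x in lborel. f x = 0"
  shows "f x = 0"
proof (rule ccontr)
  assume "f x \<noteq> 0"
  have op: "open {x. f x \<noteq> 0}"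
    using assms(1) open_Collect_neq[OF _ continuous_on_const] by blast
  have "{x. f x \<noteq> 0} \<in> null_sets lborel"
    using assms(2) op by (subst AE_iff_null_sets) auto
  then have "negligible {x. f x \<noteq> 0}"
    by (simp add: negligible_iff_null_sets null_sets_completionI)
  then show False
    using open_not_negligible[OF op] \<open>f x \<noteq> 0\<close> by blast
qed

lemma piecewise_C1_increment_lower_bound:
  fixes r :: "real \<Rightarrow> real"
  assumes r: "r piecewise_C1_differentiable_on {a..b}" and "a \<le> b"
    and der: "\<And>v. r differentiable (at v) \<Longrightarrow> - L \<le> deriv r v"
  shows "- L * (b - a) \<le> r b - r a"
proof -
  obtain S where S: "finite S" "r C1_differentiable_on ({a..b} - S)" and cont: "continuous_on {a..b} r"
    using r by (auto simp: piecewise_C1_differentiable_on_def)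
  have d: "r differentiable (at v)" if "v \<in> {a<..<b} - S" for v
    using S(2) that by (auto simp: C1_differentiable_on_eq)
  have i: "(deriv r has_integral (r b - r a)) {a..b}"
    using d cont \<open>a \<le> b\<close> S(1)
    by (intro fundamental_theorem_of_calculus_interior_strong[of S])
       (auto simp: has_real_derivative_iff_has_vector_derivative[symmetric] DERIV_deriv_iff_real_differentiable)
  \<comment> \<open>At exceptional points and at the ends of the interval \<open>deriv r\<close>
    need not be a genuine derivative. Overwriting it there by \<open>- L\<close> keeps the integral
    and makes the bound hold at every point.\<close>
  have j: "((\<lambda>v. if v \<in> S \<union> {a, b} then - L else deriv r v) has_integral (r b - r a)) {a..b}"
    by (rule has_integral_spike_finite[OF _ _ i, of "S \<union> {a, b}"]) (use S in auto)
  have k: "((\<lambda>v. - L) has_integral - L * (b - a)) {a..b}"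
    using has_integral_const_real[of "- L" a b] \<open>a \<le> b\<close> by (simp add: mult.commute)
  show ?thesis
    by (rule has_integral_le[OF k j]) (use der d in auto)
qed

subsection \<open>General normal distributions\<close>

lemma normal_density_affine_std:
  assumes "0 < s"
  shows "normal_density \<mu> s x = \<phi> ((x - \<mu>) / s) / s"
  using assms by (simp add: normal_density_def real_sqrt_mult power_divide field_simps)

lemma integral_normal_distribution:
  fixes f :: "real \<Rightarrow> real"
  assumes "0 < s" "f \<in> borel_measurable borel"
  shows "(LINT v|normal_distribution \<mu> s. f v) = (LINT z|lborel. f (\<mu> + s * z) * \<phi> z)"
proof -
  have "(LINT v|normal_distribution \<mu> s. f v) = (LINT v|lborel. normal_density \<mu> s v * f v)"
    using assms by (subst integral_density) auto
  also have "\<dots> = \<bar>s\<bar> *\<^sub>R (LINT z|lborel. normal_density \<mu> s (\<mu> + s * z) * f (\<mu> + s * z))"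
    using assms by (intro lborel_integral_real_affine) auto
  also have "\<dots> = (LINT z|lborel. f (\<mu> + s * z) * \<phi> z)"
  proof -
    have "s * (normal_density \<mu> s (\<mu> + s * z) * f (\<mu> + s * z)) = f (\<mu> + s * z) * \<phi> z" for z
      using assms(1) by (simp add: normal_density_affine_std[of s \<mu>])
    then show ?thesis
      using assms(1) by (subst real_scaleR_def, subst integral_mult_right_zero[symmetric]) (simp only: abs_of_pos)
  qed
  finally show ?thesis .
qed

lemma integrable_bounded_normal:
  fixes f :: "real \<Rightarrow> real"
  assumes "0 < s" "f \<in> borel_measurable borel" "\<And>x. \<bar>f x\<bar> \<le> B"
  shows "integrable (normal_distribution \<mu> s) f"
proof -
  interpret prob_space "normal_distribution \<mu> s" using assms(1) by (rule prob_space_normal_density)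
  show ?thesis by (rule integrable_const_bound[of _ B]) (use assms in auto)
qed

text \<open>The normal density is positive everywhere, so both measures have the same null sets.
  Almost sure statements under prior or posterior thus become statements about Lebesgue
  measure.\<close>

lemma AE_normal_iff_AE_lborel:
  assumes "0 < s"
  shows "(AE v in normal_distribution \<mu> s. Q v) \<longleftrightarrow> (AE v in lborel. Q v)"
  using normal_density_pos[OF assms] by (subst AE_density) auto

lemma continuous_AE_normal_zero:
  fixes f :: "real \<Rightarrow> real"
  assumes "0 < s" "continuous_on UNIV f" "AE v in normal_distribution \<mu> s. f v = 0"
  shows "f v = 0"
  using continuous_AE_zero[of f v] assms by (simp add: AE_normal_iff_AE_lborel)

subsection \<open>Rebate programs and posterior means\<close>

locale rebate_problem =
  fixes \<theta> \<sigma>\<^sub>\<theta> \<sigma>\<^sub>\<epsilon> p :: real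
  assumes sd_prior_pos: "0 < \<sigma>\<^sub>\<theta>" and sd_noise_pos: "0 < \<sigma>\<^sub>\<epsilon>" and price_pos: "0 < p"
begin

abbreviation "\<tau> \<equiv> tau \<sigma>\<^sub>\<theta> \<sigma>\<^sub>\<epsilon>"
abbreviation "\<sigma> \<equiv> sigma_total \<sigma>\<^sub>\<theta> \<sigma>\<^sub>\<epsilon>"
abbreviation "\<sigma>\<^sub>v \<equiv> sigma_post \<sigma>\<^sub>\<theta> \<sigma>\<^sub>\<epsilon>"
abbreviation "\<mu> \<equiv> mu_post \<theta> \<sigma>\<^sub>\<theta> \<sigma>\<^sub>\<epsilon>"
abbreviation "prior \<equiv> normal_distribution \<theta> \<sigma>\<^sub>\<theta>"
abbreviation "post \<equiv> posterior \<theta> \<sigma>\<^sub>\<theta> \<sigma>\<^sub>\<epsilon>"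
abbreviation "profit \<equiv> expected_profit \<theta> \<sigma>\<^sub>\<theta> \<sigma>\<^sub>\<epsilon> p"

text \<open>Descending from \<open>p\<close> to 0 at the maximal rate \<open>1 / \<tau>\<close>
  takes a width of \<open>\<tau> * p\<close>. Fixing this width builds the second equation of the
  system into every ramp.\<close>

definition R :: "real \<Rightarrow> real \<Rightarrow> real" where
  "R a = rc_program \<tau> p a (a + \<tau> * p)"

lemma variance_pos: "0 < \<sigma>\<^sub>\<theta>\<^sup>2 + \<sigma>\<^sub>\<epsilon>\<^sup>2"
  using sd_prior_pos sd_noise_pos by (simp add: add_pos_pos)

lemma tau_pos: "0 < \<tau>"
  using sd_prior_pos variance_pos by (simp add: tau_def add.commute)

lemma sigma_pos: "0 < \<sigma>"
  using variance_pos by (simp add: sigma_total_def)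

lemma sigma_post_pos: "0 < \<sigma>\<^sub>v"
  using sd_prior_pos sd_noise_pos variance_pos by (simp add: sigma_post_def add.commute)

lemma noise_le_sigma: "\<sigma>\<^sub>\<epsilon> \<le> \<sigma>"
  unfolding sigma_total_def by (rule real_le_rsqrt) simp

lemma prob_space_prior: "prob_space prior"
  using sd_prior_pos by (rule prob_space_normal_density)

lemma prob_space_post: "prob_space (post x)"
  unfolding posterior_def using sigma_post_pos by (rule prob_space_normal_density)

text \<open>As a clamped affine function the ramp is visibly continuous, bounded and Lipschitz with
  constant \<open>1 / \<tau>\<close>.\<close>

lemma R_eq_clamp: "R a v = max 0 (min p (p - (v - a) / \<tau>))"
proof -
  have "(v - a) / \<tau> \<le> 0" if "v < a"
    using that tau_pos by (simp add: divide_le_0_iff)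
  moreover have "(v - a) / \<tau> < p \<longleftrightarrow> v < a + \<tau> * p" "0 \<le> (v - a) / \<tau> \<longleftrightarrow> a \<le> v"
    using tau_pos by (auto simp: pos_divide_less_eq zero_le_divide_iff algebra_simps)
  ultimately show ?thesis
    using price_pos by (auto simp: R_def rc_program_def max_def min_def)
qed

text \<open>Positive parts are the form whose normal expectation is computed by \<Psi>.\<close>

lemma R_eq_pos_parts: "R a v = (max 0 (a + \<tau> * p - v) - max 0 (a - v)) / \<tau>"
proof -
  have "a < a + \<tau> * p" using tau_pos price_pos by simp
  then show ?thesis
    using tau_pos by (auto simp: R_def rc_program_def max_def diff_divide_distrib add_divide_distrib)
qed

lemma R_nonneg: "0 \<le> R a v" and R_le: "R a v \<le> p"
  using price_pos unfolding R_eq_clamp by auto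

lemma abs_R_le: "\<bar>R a v\<bar> \<le> p"
  using R_nonneg[of a v] R_le[of a v] by simp

lemma R_lipschitz: "\<bar>R a v - R b w\<bar> \<le> \<bar>(v - a) - (w - b)\<bar> / \<tau>"
proof -
  have "\<bar>R a v - R b w\<bar> \<le> \<bar>(p - (v - a) / \<tau>) - (p - (w - b) / \<tau>)\<bar>"
    unfolding R_eq_clamp by linarith
  also have "\<dots> = \<bar>((w - b) - (v - a)) / \<tau>\<bar>"
    by (simp add: diff_divide_distrib)
  finally show ?thesis
    using tau_pos by (simp add: abs_minus_commute)
qed

lemma continuous_on_R: "continuous_on S (R a)"
  unfolding R_eq_clamp[abs_def] using tau_pos by (intro continuous_intros) simp

lemma measurable_R [measurable]: "R a \<in> borel_measurable borel"
  by (rule borel_measurable_continuous_onI[OF continuous_on_R])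

lemma has_real_derivative_R:
  assumes "v \<noteq> a" "v \<noteq> a + \<tau> * p"
  shows "(R a has_real_derivative (if v \<in> {a<..<a + \<tau> * p} then - 1 / \<tau> else 0)) (at v)"
proof -
  have le: "a < a + \<tau> * p" using tau_pos price_pos by simp
  consider "v < a" | "v \<in> {a<..<a + \<tau> * p}" | "a + \<tau> * p < v" using assms by force
  then show ?thesis
  proof cases
    case 1
    have "((\<lambda>v. p) has_real_derivative 0) (at v)" by simp
    from has_field_derivative_transform_within_open[OF this, of "{..<a}" "R a"] 1 show ?thesis
      by (simp add: R_def rc_program_def)
  next
    case 2
    have "((\<lambda>v. p - 1 / \<tau> * (v - a)) has_real_derivative - 1 / \<tau>) (at v)"
      by (rule derivative_eq_intros refl | simp)+
    from has_field_derivative_transform_within_open[OF this, of "{a<..<a + \<tau> * p}" "R a"] 2 show ?thesis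
      by (simp add: R_def rc_program_def)
  next
    case 3
    have "((\<lambda>v. 0) has_real_derivative 0) (at v)" by simp
    from has_field_derivative_transform_within_open[OF this, of "{a + \<tau> * p<..}" "R a"] 3 le show ?thesis
      by (simp add: R_def rc_program_def)
  qed
qed

lemma R_piecewise_C1: "R a piecewise_C1_differentiable_on I"
  unfolding piecewise_C1_differentiable_on_def
proof (intro conjI exI)
  let ?D = "\<lambda>v. if v \<in> {a<..<a + \<tau> * p} then - 1 / \<tau> else 0"
  have "continuous_on (({a<..<a + \<tau> * p} \<union> ({..<a} \<union> {a + \<tau> * p<..}))) ?D"
  proof (rule continuous_on_open_Un)
    show "continuous_on {a<..<a + \<tau> * p} ?D"
      by (rule continuous_on_eq[OF continuous_on_const[of _ "- 1 / \<tau>"]]) auto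
    show "continuous_on ({..<a} \<union> {a + \<tau> * p<..}) ?D"
      by (rule continuous_on_eq[OF continuous_on_const[of _ 0]]) (use tau_pos price_pos in auto)
  qed auto
  then have "continuous_on (I - {a, a + \<tau> * p}) ?D"
    by (rule continuous_on_subset) auto
  then show "R a C1_differentiable_on (I - {a, a + \<tau> * p})"
    unfolding C1_differentiable_on_def
    using has_real_derivative_R[of _ a]
    by (intro exI[of _ ?D]) (auto simp flip: has_real_derivative_iff_has_vector_derivative)
qed (auto simp: continuous_on_R)

lemma rate_constrained_R: "rate_constrained p (1 / \<tau>) (R a)"
  unfolding rate_constrained_def
proof (intro conjI allI impI)
  fix v assume "R a differentiable (at v)"
  then have "(R a has_real_derivative deriv (R a) v) (at v)"
    by (simp add: DERIV_deriv_iff_real_differentiable)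
  \<comment> \<open>The absolute derivative is a limit of difference quotients, each bounded by the
    Lipschitz constant. No distinction by the position of \<open>v\<close> is needed.\<close>
  then have "((\<lambda>w. \<bar>(R a w - R a v) / (w - v)\<bar>) \<longlongrightarrow> \<bar>deriv (R a) v\<bar>) (at v)"
    by (intro tendsto_rabs) (simp add: has_field_derivative_iff)
  then show "\<bar>deriv (R a) v\<bar> \<le> 1 / \<tau>"
  proof (rule tendsto_upperbound)
    show "\<forall>\<^sub>F w in at v. \<bar>(R a w - R a v) / (w - v)\<bar> \<le> 1 / \<tau>"
      using tau_pos R_lipschitz[of a _ a v]
      by (intro eventuallyI) (auto simp: abs_divide divide_simps)
  qed simp
qed (use R_nonneg R_le in \<open>auto simp: continuous_on_R R_piecewise_C1\<close>)

text \<open>The joint density of quality and valuation is factored in two ways: prior times noise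
  density, and marginal density of the valuation \<open>x\<close> times posterior density. The proof
  completes the square in the exponent.\<close>

lemma bayes:
  "normal_density \<theta> \<sigma>\<^sub>\<theta> v * (\<phi> ((v - x) / \<sigma>\<^sub>\<epsilon>) / \<sigma>\<^sub>\<epsilon>) =
     \<phi> ((\<theta> - x) / \<sigma>) / \<sigma> * normal_density (\<mu> x) \<sigma>\<^sub>v v"
proof -
  define A B where "A = \<sigma>\<^sub>\<theta>\<^sup>2" and "B = \<sigma>\<^sub>\<epsilon>\<^sup>2"
  have AB: "0 < A" "0 < B" "0 < A + B"
    using sd_prior_pos sd_noise_pos by (auto simp: A_def B_def add_pos_pos)
  have sq: "\<sigma>\<^sup>2 = A + B" "\<sigma>\<^sub>v\<^sup>2 = A * B / (A + B)"
    using AB by (auto simp: sigma_total_def sigma_post_def A_def B_def power_mult_distrib power_divide add.commute)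
  have mu: "\<mu> x = (A * x + B * \<theta>) / (A + B)"
  proof -
    have "1 - A / (B + A) = B / (A + B)" using AB by (simp add: field_simps)
    then show ?thesis
      unfolding mu_post_def tau_def A_def[symmetric] B_def[symmetric]
      by (simp add: add.commute add_divide_distrib)
  qed
  have prod: "\<sigma> * \<sigma>\<^sub>v = \<sigma>\<^sub>\<theta> * \<sigma>\<^sub>\<epsilon>"
    using variance_pos by (simp add: sigma_total_def sigma_post_def add.commute)
  \<comment> \<open>Over the common denominator \<open>A * B * (A + B)\<close> the claim becomes a
    polynomial identity in \<open>s = v - x\<close> and \<open>t = v - \<theta>\<close>.\<close>
  have square: "(v - \<theta>)\<^sup>2 / A + (v - x)\<^sup>2 / B = (\<theta> - x)\<^sup>2 / (A + B) + (v - \<mu> x)\<^sup>2 / (A * B / (A + B))"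
  proof -
    have "(v - \<mu> x) = (A * (v - x) + B * (v - \<theta>)) / (A + B)"
      using AB unfolding mu by (simp add: field_simps)
    then have "(v - \<mu> x)\<^sup>2 / (A * B / (A + B)) = (A * (v - x) + B * (v - \<theta>))\<^sup>2 / (A * B * (A + B))"
      using AB by (simp add: power_divide power2_eq_square)
    moreover have "(\<theta> - x)\<^sup>2 / (A + B) = A * B * ((v - x) - (v - \<theta>))\<^sup>2 / (A * B * (A + B))"
      using AB by (simp add: mult.assoc)
    moreover have "(v - \<theta>)\<^sup>2 / A + (v - x)\<^sup>2 / B = (B * (v - \<theta>)\<^sup>2 + A * (v - x)\<^sup>2) * (A + B) / (A * B * (A + B))"
      using AB by (simp add: add_divide_distrib)
    moreover have "(B * t\<^sup>2 + A * s\<^sup>2) * (A + B) = A * B * (s - t)\<^sup>2 + (A * s + B * t)\<^sup>2" for s t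
      by (simp add: power2_eq_square algebra_simps)
    ultimately show ?thesis
      by (simp only: add_divide_distrib)
  qed
  have gauss: "\<phi> ((y - m) / s) = 1 / sqrt (2 * pi) * exp (- ((y - m)\<^sup>2 / s\<^sup>2) / 2)" for y m s
    by (simp add: std_normal_density_def power_divide)
  have "\<phi> ((v - \<theta>) / \<sigma>\<^sub>\<theta>) * \<phi> ((v - x) / \<sigma>\<^sub>\<epsilon>) = \<phi> ((\<theta> - x) / \<sigma>) * \<phi> ((v - \<mu> x) / \<sigma>\<^sub>v)"
  proof -
    have "exp (- ((v - \<theta>)\<^sup>2 / A) / 2) * exp (- ((v - x)\<^sup>2 / B) / 2) =
        exp (- ((\<theta> - x)\<^sup>2 / (A + B)) / 2) * exp (- ((v - \<mu> x)\<^sup>2 / (A * B / (A + B))) / 2)"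
    proof -
      have "- a / 2 + - b / 2 = - c / 2 + - d / 2" if "a + b = c + d" for a b c d :: real
        using that by argo
      from this[OF square] show ?thesis
        by (simp only: exp_add[symmetric])
    qed
    then show ?thesis
      unfolding gauss sq A_def[symmetric] B_def[symmetric] by (simp add: mult_ac)
  qed
  then show ?thesis
    using prod unfolding normal_density_affine_std[OF sd_prior_pos] normal_density_affine_std[OF sigma_post_pos]
    by (simp add: mult.assoc)
qed

lemma integral_posterior:
  assumes [measurable]: "f \<in> borel_measurable borel"
  shows "(LINT v|prior. f v * (\<phi> ((v - x) / \<sigma>\<^sub>\<epsilon>) / \<sigma>\<^sub>\<epsilon>)) = \<phi> ((\<theta> - x) / \<sigma>) / \<sigma> * (LINT v|post x. f v)"
proof -
  have "(LINT v|prior. f v * (\<phi> ((v - x) / \<sigma>\<^sub>\<epsilon>) / \<sigma>\<^sub>\<epsilon>))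
      = (LINT v|lborel. normal_density \<theta> \<sigma>\<^sub>\<theta> v * (f v * (\<phi> ((v - x) / \<sigma>\<^sub>\<epsilon>) / \<sigma>\<^sub>\<epsilon>)))"
    by (subst integral_density) auto
  also have "\<dots> = (LINT v|lborel. \<phi> ((\<theta> - x) / \<sigma>) / \<sigma> * (normal_density (\<mu> x) \<sigma>\<^sub>v v * f v))"
    by (intro Bochner_Integration.integral_cong refl) (metis bayes mult.assoc mult.commute)
  also have "\<dots> = \<phi> ((\<theta> - x) / \<sigma>) / \<sigma> * (LINT v|post x. f v)"
    unfolding posterior_def by (subst integral_density) auto
  finally show ?thesis .
qed

section \<open>The posterior mean of a ramp\<close>

text \<open>\<open>H m\<close> is the posterior mean of a ramp starting at distance \<open>m\<close> below the mean \<open>\<mu>\<^sub>c\<close>.\<close>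

definition H :: "real \<Rightarrow> real" where
  "H m = \<sigma>\<^sub>v / \<tau> * (\<Psi> ((\<tau> * p - m) / \<sigma>\<^sub>v) - \<Psi> (- m / \<sigma>\<^sub>v))"

text \<open>\<open>P m\<close> is the posterior probability that the quality lies on the sloped part of the ramp.\<close>

definition P :: "real \<Rightarrow> real" where
  "P m = \<Phi> ((\<tau> * p - m) / \<sigma>\<^sub>v) - \<Phi> (- m / \<sigma>\<^sub>v)"

text \<open>Standardising by \<open>v = y + \<sigma>\<^sub>v * z\<close> turns both positive parts
  of the ramp into multiples of \<open>max 0 (k - z)\<close>, with expectation
  \<open>\<Psi> k\<close>.\<close>

lemma integral_R_normal: "(LINT v|normal_distribution y \<sigma>\<^sub>v. R a v) = H (y - a)"
proof -
  have scale: "max 0 t = \<sigma>\<^sub>v * max 0 (t / \<sigma>\<^sub>v)" for t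
    using sigma_post_pos by (auto simp: max_def zero_le_divide_iff)
  have "R a (y + \<sigma>\<^sub>v * z) * \<phi> z = \<sigma>\<^sub>v / \<tau> *
      (max 0 ((\<tau> * p - (y - a)) / \<sigma>\<^sub>v - z) * \<phi> z - max 0 (- (y - a) / \<sigma>\<^sub>v - z) * \<phi> z)" for z
  proof -
    have "(a + \<tau> * p - (y + \<sigma>\<^sub>v * z)) / \<sigma>\<^sub>v = (\<tau> * p - (y - a)) / \<sigma>\<^sub>v - z"
      "(a - (y + \<sigma>\<^sub>v * z)) / \<sigma>\<^sub>v = - (y - a) / \<sigma>\<^sub>v - z"
      using sigma_post_pos by (simp_all add: field_simps)
    then have "R a (y + \<sigma>\<^sub>v * z) = (\<sigma>\<^sub>v * max 0 ((\<tau> * p - (y - a)) / \<sigma>\<^sub>v - z)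
        - \<sigma>\<^sub>v * max 0 (- (y - a) / \<sigma>\<^sub>v - z)) / \<tau>"
      unfolding R_eq_pos_parts scale[of "a + \<tau> * p - (y + \<sigma>\<^sub>v * z)"] scale[of "a - (y + \<sigma>\<^sub>v * z)"]
      by simp
    then show ?thesis
      by (simp only:) (simp add: left_diff_distrib right_diff_distrib diff_divide_distrib)
  qed
  then have "(LINT v|normal_distribution y \<sigma>\<^sub>v. R a v) = (LINT z|lborel. \<sigma>\<^sub>v / \<tau> *
      (max 0 ((\<tau> * p - (y - a)) / \<sigma>\<^sub>v - z) * \<phi> z - max 0 (- (y - a) / \<sigma>\<^sub>v - z) * \<phi> z))"
    using sigma_post_pos by (simp only: integral_normal_distribution measurable_R)
  also have "\<dots> = H (y - a)"
    by (simp only: integral_mult_right_zero Bochner_Integration.integral_diff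
        integrable_pos_part_phi integral_pos_part_phi H_def)
  finally show ?thesis .
qed

lemma integral_R_post: "(LINT v|post x. R a v) = H (\<mu> x - a)"
  unfolding posterior_def by (rule integral_R_normal)

lemma P_pos: "0 < P m"
proof -
  have "- m / \<sigma>\<^sub>v < (\<tau> * p - m) / \<sigma>\<^sub>v"
    using sigma_post_pos tau_pos price_pos by (intro divide_strict_right_mono) auto
  then show ?thesis
    unfolding P_def by (simp only: Phi_strict_mono diff_gt_0_iff_gt)
qed

lemma P_less_1: "P m < 1"
  unfolding P_def using Phi_pos[of "- m / \<sigma>\<^sub>v"] Phi_le_1[of "(\<tau> * p - m) / \<sigma>\<^sub>v"] by simp

lemma has_real_derivative_H: "(H has_real_derivative - P m / \<tau>) (at m)"
proof -
  have "((\<lambda>m. \<Psi> ((\<tau> * p - m) / \<sigma>\<^sub>v)) has_real_derivative \<Phi> ((\<tau> * p - m) / \<sigma>\<^sub>v) * (- 1 / \<sigma>\<^sub>v)) (at m)"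
    by (rule DERIV_chain2[OF has_real_derivative_Psi]) (use sigma_post_pos in \<open>auto intro!: derivative_eq_intros\<close>)
  moreover have "((\<lambda>m. \<Psi> (- m / \<sigma>\<^sub>v)) has_real_derivative \<Phi> (- m / \<sigma>\<^sub>v) * (- 1 / \<sigma>\<^sub>v)) (at m)"
    by (rule DERIV_chain2[OF has_real_derivative_Psi]) (use sigma_post_pos in \<open>auto intro!: derivative_eq_intros\<close>)
  ultimately have "(H has_real_derivative \<sigma>\<^sub>v / \<tau> * (\<Phi> ((\<tau> * p - m) / \<sigma>\<^sub>v) * (- 1 / \<sigma>\<^sub>v) - \<Phi> (- m / \<sigma>\<^sub>v) * (- 1 / \<sigma>\<^sub>v))) (at m)"
    unfolding H_def[abs_def] by (intro DERIV_cmult DERIV_diff)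
  moreover have "\<sigma>\<^sub>v / \<tau> * (\<Phi> ((\<tau> * p - m) / \<sigma>\<^sub>v) * (- 1 / \<sigma>\<^sub>v) - \<Phi> (- m / \<sigma>\<^sub>v) * (- 1 / \<sigma>\<^sub>v)) = - P m / \<tau>"
    using sigma_post_pos unfolding P_def by (simp add: left_diff_distrib right_diff_distrib diff_divide_distrib)
  ultimately show ?thesis by simp
qed

lemma continuous_on_H: "continuous_on S H"
  using has_real_derivative_H by (intro continuous_at_imp_continuous_on) (blast intro: DERIV_isCont)

lemma H_strict_decreasing: "m < n \<Longrightarrow> H n < H m"
  by (rule DERIV_neg_imp_decreasing)
    (use has_real_derivative_H P_pos tau_pos in \<open>auto intro!: exI simp: divide_neg_pos\<close>)

lemma H_lipschitz: "\<bar>H m - H n\<bar> \<le> \<bar>m - n\<bar> / \<tau>"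
proof -
  have "norm (H m - H n) \<le> 1 / \<tau> * norm (m - n)"
  proof (rule field_differentiable_bound[of UNIV H "\<lambda>m. - P m / \<tau>"])
    show "norm (- P m / \<tau>) \<le> 1 / \<tau>" for m
      using P_pos[of m] P_less_1[of m] tau_pos by (simp add: divide_right_mono)
  qed (use has_real_derivative_H in auto)
  then show ?thesis by simp
qed

lemma H_eq: "H m = (LINT v|normal_distribution 0 \<sigma>\<^sub>v. R (- m) v)"
  by (simp add: integral_R_normal)

lemma integrable_R: "0 < s \<Longrightarrow> integrable (normal_distribution y s) (R a)"
  by (rule integrable_bounded_normal[where B=p]) (auto simp: abs_R_le)

lemma H_nonneg: "0 \<le> H m" and H_le_price: "H m \<le> p"
proof -
  interpret prob_space "normal_distribution 0 \<sigma>\<^sub>v" using sigma_post_pos by (rule prob_space_normal_density)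
  show "0 \<le> H m"
    unfolding H_eq by (rule Bochner_Integration.integral_nonneg) (rule R_nonneg)
  have "H m \<le> (LINT v|normal_distribution 0 \<sigma>\<^sub>v. p)"
    unfolding H_eq by (rule integral_mono) (auto simp: R_le integrable_R[OF sigma_post_pos])
  then show "H m \<le> p"
    using prob_space by simp
qed

lemma H_pos: "0 < H m"
  using H_strict_decreasing[of m "m + 1"] H_nonneg[of "m + 1"] by simp

lemma H_less_price: "H m < p"
  using H_strict_decreasing[of "m - 1" m] H_le_price[of "m - 1"] by simp

lemma H_tendsto_at_top: "(H \<longlongrightarrow> 0) at_top"
proof -
  interpret prob_space "normal_distribution 0 \<sigma>\<^sub>v" using sigma_post_pos by (rule prob_space_normal_density)
  have "((\<lambda>m. LINT v|normal_distribution 0 \<sigma>\<^sub>v. R (- m) v) \<longlongrightarrow> (LINT v|normal_distribution 0 \<sigma>\<^sub>v. 0)) at_top"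
  proof (rule integral_dominated_convergence_at_top[where w="\<lambda>_. p"])
    have "((\<lambda>m. R (- m) v) \<longlongrightarrow> 0) at_top" for v
      by (rule tendsto_eventually, rule eventually_mono[OF eventually_ge_at_top[of "max (- v) (\<tau> * p - v)"]])
         (use mult_pos_pos[OF tau_pos price_pos] in \<open>auto simp: R_def rc_program_def\<close>)
    then show "AE v in normal_distribution 0 \<sigma>\<^sub>v. ((\<lambda>m. R (- m) v) \<longlongrightarrow> 0) at_top"
      by simp
  qed (auto simp: abs_R_le)
  then show ?thesis by (simp flip: H_eq)
qed

lemma H_tendsto_at_bot: "(H \<longlongrightarrow> p) at_bot"
proof -
  interpret prob_space "normal_distribution 0 \<sigma>\<^sub>v" using sigma_post_pos by (rule prob_space_normal_density)
  \<comment> \<open>The parameter is reflected: the limit of \<open>H\<close> at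
    \<open>at_bot\<close> becomes one at \<open>at_top\<close>, where dominated convergence is
    applied.\<close>
  have "((\<lambda>m. LINT v|normal_distribution 0 \<sigma>\<^sub>v. R m v) \<longlongrightarrow> (LINT v|normal_distribution 0 \<sigma>\<^sub>v. p)) at_top"
  proof (rule integral_dominated_convergence_at_top[where w="\<lambda>_. p"])
    have "((\<lambda>m. R m v) \<longlongrightarrow> p) at_top" for v
      by (rule tendsto_eventually, rule eventually_mono[OF eventually_gt_at_top[of v]])
         (auto simp: R_def rc_program_def)
    then show "AE v in normal_distribution 0 \<sigma>\<^sub>v. ((\<lambda>m. R m v) \<longlongrightarrow> p) at_top"
      by simp
  qed (auto simp: abs_R_le)
  then show ?thesis
    using prob_space by (simp add: filterlim_at_bot_mirror H_eq)
qed

lemma H_surj: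
  assumes "0 < y" "y < p"
  shows "\<exists>m. H m = y"
proof -
  obtain a where a: "y < H a"
    using order_tendstoD(1)[OF H_tendsto_at_bot assms(2)] by (auto simp: eventually_at_bot_linorder)
  obtain b where b: "H b < y"
    using order_tendstoD(2)[OF H_tendsto_at_top assms(1)] by (auto simp: eventually_at_top_linorder)
  have "a \<le> b" using H_strict_decreasing[of b a] a b by force
  then show ?thesis
    using IVT2'[of H b y a] a b continuous_on_H by auto
qed

text \<open>Left of the slope the ramp pays the maximum \<open>p\<close>, right of it the minimum 0.
  On the slope it falls at the fastest admissible rate, so \<open>r - R a\<close> is nondecreasing
  there and has a zero by the intermediate value theorem.\<close>

lemma single_crossing:
  assumes r: "rate_constrained p (1 / \<tau>) r"
  shows "\<exists>z. r z = R a z \<and> (\<forall>v<z. r v \<le> R a v) \<and> (\<forall>v>z. R a v \<le> r v)"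
proof -
  let ?d = "\<lambda>v. r v - R a v"
  have r0: "0 \<le> r v" "r v \<le> p" for v
    using r by (auto simp: rate_constrained_def)
  have le: "a \<le> a + \<tau> * p" using tau_pos price_pos by simp
  have neg: "?d v \<le> 0" if "v \<le> a" for v
    using r0[of v] that tau_pos price_pos by (auto simp: R_def rc_program_def)
  have pos: "0 \<le> ?d v" if "a + \<tau> * p \<le> v" for v
    using r0[of v] that le by (auto simp: R_def rc_program_def)
  have mono: "?d v \<le> ?d w" if "a \<le> v" "v \<le> w" "w \<le> a + \<tau> * p" for v w
  proof -
    have "- (1 / \<tau>) * (w - v) \<le> r w - r v"
      using r that(2) by (intro piecewise_C1_increment_lower_bound) (auto simp: rate_constrained_def abs_le_iff)
    moreover have "R a w - R a v = - (1 / \<tau>) * (w - v)"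
      using that tau_pos by (auto simp: R_def rc_program_def field_simps)
    ultimately show ?thesis by linarith
  qed
  have "continuous_on {a..a + \<tau> * p} ?d"
    using r by (intro continuous_intros continuous_on_R) (auto simp: rate_constrained_def intro: continuous_on_subset)
  then obtain z where z: "a \<le> z" "z \<le> a + \<tau> * p" "?d z = 0"
    using IVT'[of ?d a 0 "a + \<tau> * p"] neg pos le by auto
  have "?d v \<le> 0" if "v < z" for v
    using neg[of v] mono[of v z] z that by (cases "v \<le> a") auto
  moreover have "0 \<le> ?d v" if "z < v" for v
    using pos[of v] mono[of z v] z that by (cases "a + \<tau> * p \<le> v") auto
  ultimately show ?thesis using z(3) by (intro exI[of _ z]) auto
qed

subsection \<open>Optimality for a fixed cutoff\<close>

definition cutoff :: "real \<Rightarrow> real" where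
  "cutoff m = p - H m"

definition lower :: "real \<Rightarrow> real" where
  "lower m = \<mu> (cutoff m) - m"

definition J :: "real \<Rightarrow> real" where
  "J m = profit (cutoff m) (R (lower m))"

lemma integral_R_lower: "(LINT v|post (cutoff m). R (lower m) v) = H m"
  by (simp add: integral_R_post lower_def)

lemma feasible_R: "feasible \<theta> \<sigma>\<^sub>\<theta> \<sigma>\<^sub>\<epsilon> p (cutoff m) (R (lower m))"
  unfolding feasible_def integral_R_lower using rate_constrained_R by (simp add: cutoff_def)

lemma integrable_times_Phi:
  assumes [measurable]: "f \<in> borel_measurable borel" and "\<And>v. \<bar>f v\<bar> \<le> B"
  shows "integrable prior (\<lambda>v. f v * \<Phi> ((v - x) / \<sigma>\<^sub>\<epsilon>))"
proof (rule integrable_bounded_normal[OF sd_prior_pos, where B="B * 1"])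
  show "\<bar>f v * \<Phi> ((v - x) / \<sigma>\<^sub>\<epsilon>)\<bar> \<le> B * 1" for v
    unfolding abs_mult using assms(2)[of v] Phi_nonneg Phi_le_1 by (intro mult_mono) auto
qed measurable

lemma integrable_times_phi:
  assumes [measurable]: "f \<in> borel_measurable borel" and "\<And>v. \<bar>f v\<bar> \<le> B"
  shows "integrable prior (\<lambda>v. f v * \<phi> ((v - x) / \<sigma>\<^sub>\<epsilon>))"
proof (rule integrable_bounded_normal[OF sd_prior_pos, where B="B * 1"])
  show "\<bar>f v * \<phi> ((v - x) / \<sigma>\<^sub>\<epsilon>)\<bar> \<le> B * 1" for v
    unfolding abs_mult using assms(2)[of v] phi_le_1 by (intro mult_mono) auto
qed measurable

lemma integral_times_phi:
  assumes "f \<in> borel_measurable borel"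
  shows "(LINT v|prior. f v * \<phi> ((v - x) / \<sigma>\<^sub>\<epsilon>)) = \<sigma>\<^sub>\<epsilon> * (\<phi> ((\<theta> - x) / \<sigma>) / \<sigma>) * (LINT v|post x. f v)"
proof -
  have "(LINT v|prior. f v * \<phi> ((v - x) / \<sigma>\<^sub>\<epsilon>)) = \<sigma>\<^sub>\<epsilon> * (LINT v|prior. f v * (\<phi> ((v - x) / \<sigma>\<^sub>\<epsilon>) / \<sigma>\<^sub>\<epsilon>))"
    using sd_noise_pos by (subst integral_mult_right_zero[symmetric]) simp
  then show ?thesis
    using integral_posterior[OF assms, of x] by (simp only: mult.assoc)
qed

lemma rate_constrained_measurable: "rate_constrained p L r \<Longrightarrow> r \<in> borel_measurable borel"
  by (auto simp: rate_constrained_def intro: borel_measurable_continuous_onI)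

lemma rate_constrained_bounds: "rate_constrained p L r \<Longrightarrow> 0 \<le> r v \<and> r v \<le> p"
  by (auto simp: rate_constrained_def)

text \<open>A Neyman-Pearson exchange argument. At the crossing point both factors of
  \<open>g\<close> change sign from negative to positive, so \<open>g\<close> is nonnegative. Its
  \<open>\<phi>\<close> term integrates to zero because the posterior means agree, which leaves the
  difference of the profits.\<close>

lemma R_optimal_for_cutoff:
  assumes r: "rate_constrained p (1 / \<tau>) r"
    and eq: "(LINT v|post x. r v) = (LINT v|post x. R a v)"
  shows "profit x r \<le> profit x (R a)"
    and "profit x r = profit x (R a) \<Longrightarrow> r = R a"
proof -
  note [measurable] = rate_constrained_measurable[OF r]
  note bounds = rate_constrained_bounds[OF r]
  obtain z where z: "r z = R a z" "\<And>v. v < z \<Longrightarrow> r v \<le> R a v" "\<And>v. z < v \<Longrightarrow> R a v \<le> r v"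
    using single_crossing[OF r, of a] by blast
  define u where "u v = (v - x) / \<sigma>\<^sub>\<epsilon>" for v
  \<comment> \<open>The multiplier of the indifference constraint, chosen so that
    \<open>\<Phi> (u v) - l * \<phi> (u v)\<close> vanishes at the crossing point.\<close>
  define l where "l = \<Phi> (u z) / \<phi> (u z)"
  define g where "g v = (r v - R a v) * (\<Phi> (u v) - l * \<phi> (u v))" for v
  have neg: "\<Phi> (u v) - l * \<phi> (u v) < 0" if "v < z" for v
    using mills_strict_mono[of "u v" "u z"] that sd_noise_pos phi_pos[of "u v"]
    by (simp add: u_def l_def divide_strict_right_mono pos_divide_less_eq)
  have pos: "0 < \<Phi> (u v) - l * \<phi> (u v)" if "z < v" for v
    using mills_strict_mono[of "u z" "u v"] that sd_noise_pos phi_pos[of "u v"]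
    by (simp add: u_def l_def divide_strict_right_mono pos_less_divide_eq)
  have g_nonneg: "0 \<le> g v" for v
    using z neg[of v] pos[of v] unfolding g_def
    by (cases v z rule: linorder_cases) (auto intro: mult_nonpos_nonpos mult_nonneg_nonneg)
  have g_zero: "r v - R a v = 0" if "g v = 0" for v
    using that z(1) neg[of v] pos[of v] unfolding g_def
    by (cases v z rule: linorder_cases) auto
  have bd: "\<bar>r v - R a v\<bar> \<le> p" "\<bar>p - r v\<bar> \<le> p" "\<bar>p - R a v\<bar> \<le> p" for v
    using bounds[of v] R_nonneg[of a v] R_le[of a v] by auto
  have int: "integrable prior (\<lambda>v. (r v - R a v) * \<Phi> (u v))" "integrable prior (\<lambda>v. (r v - R a v) * \<phi> (u v))"
    "integrable prior (\<lambda>v. (p - r v) * \<Phi> (u v))" "integrable prior (\<lambda>v. (p - R a v) * \<Phi> (u v))"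
    unfolding u_def using bd by (auto intro!: integrable_times_Phi integrable_times_phi)
  have g_eq: "g v = (r v - R a v) * \<Phi> (u v) - l * ((r v - R a v) * \<phi> (u v))" for v
    by (simp add: g_def algebra_simps)
  have int_g: "integrable prior g"
    unfolding g_eq[abs_def] using int by auto
  have "integrable (post x) r" "integrable (post x) (R a)"
    unfolding posterior_def using bounds abs_R_le
    by (auto intro!: integrable_bounded_normal[OF sigma_post_pos, where B=p])
  then have "(LINT v|post x. r v - R a v) = 0"
    using eq by simp
  then have zero: "(LINT v|prior. (r v - R a v) * \<phi> (u v)) = 0"
    unfolding u_def by (subst integral_times_phi) auto
  have "profit x (R a) - profit x r = (LINT v|prior. (p - R a v) * \<Phi> (u v) - (p - r v) * \<Phi> (u v))"
    unfolding expected_profit_def u_def[symmetric] using int by simp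
  also have "\<dots> = (LINT v|prior. (r v - R a v) * \<Phi> (u v))"
    by (rule Bochner_Integration.integral_cong) (auto simp: algebra_simps)
  also have "\<dots> = (LINT v|prior. g v)"
    unfolding g_eq[abs_def] using int zero by simp
  finally have diff: "profit x (R a) - profit x r = (LINT v|prior. g v)" .
  show "profit x r \<le> profit x (R a)"
  proof -
    have "0 \<le> (LINT v|prior. g v)"
      using g_nonneg by (intro Bochner_Integration.integral_nonneg)
    then show ?thesis using diff by linarith
  qed
  \<comment> \<open>Equal profits force \<open>g\<close> to vanish almost everywhere. Away from
    \<open>z\<close> its second factor is nonzero and at \<open>z\<close> the programs agree, so
    \<open>r = R a\<close> almost everywhere, and then everywhere by continuity.\<close>
  show "r = R a" if "profit x r = profit x (R a)"
  proof
    fix v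
    have "AE v in prior. g v = 0"
      using diff that integral_nonneg_eq_0_iff_AE[OF int_g] g_nonneg by simp
    then have "AE v in prior. r v - R a v = 0"
      by eventually_elim (rule g_zero)
    moreover have "continuous_on UNIV (\<lambda>v. r v - R a v)"
      using r by (intro continuous_intros continuous_on_R) (simp add: rate_constrained_def)
    ultimately show "r v = R a v"
      using continuous_AE_normal_zero[OF sd_prior_pos] by force
  qed
qed

section \<open>Reduction of feasible pairs to ramps\<close>

definition no_rebate_profit :: real where
  "no_rebate_profit = profit p (\<lambda>_. 0)"

lemma no_rebate_profit_nonneg: "0 \<le> no_rebate_profit"
  unfolding no_rebate_profit_def expected_profit_def
  using price_pos Phi_nonneg by (intro Bochner_Integration.integral_nonneg) simp

text \<open>Ramps realise exactly the posterior means strictly between 0 and \<open>p\<close>. By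
  continuity, mean 0 forces the zero rebate and mean \<open>p\<close> the full rebate, which earns
  nothing; both fall under the second alternative.\<close>

lemma feasible_cases:
  assumes "feasible \<theta> \<sigma>\<^sub>\<theta> \<sigma>\<^sub>\<epsilon> p x r"
  shows "(\<exists>m. x = cutoff m \<and> profit x r \<le> J m \<and> (profit x r = J m \<longrightarrow> r = R (lower m)))
    \<or> profit x r \<le> no_rebate_profit"
proof -
  have r: "rate_constrained p (1 / \<tau>) r" and x: "x = p - (LINT v|post x. r v)"
    using assms by (auto simp: feasible_def)
  note [measurable] = rate_constrained_measurable[OF r]
  note bounds = rate_constrained_bounds[OF r]
  interpret post: prob_space "post x" by (rule prob_space_post)
  have int: "integrable (post x) r"
    unfolding posterior_def using bounds by (auto intro!: integrable_bounded_normal[OF sigma_post_pos, where B=p])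
  have cont: "continuous_on UNIV r" "continuous_on UNIV (\<lambda>v. p - r v)"
    using r by (auto simp: rate_constrained_def intro!: continuous_intros)
  have I0: "0 \<le> (LINT v|post x. r v)"
    using bounds by (intro Bochner_Integration.integral_nonneg) simp
  have d: "(LINT v|post x. p - r v) = p - (LINT v|post x. r v)"
    using int post.prob_space by simp
  have I1: "(LINT v|post x. r v) \<le> p"
    using Bochner_Integration.integral_nonneg[where M="post x" and f="\<lambda>v. p - r v"] bounds d by simp
  consider "(LINT v|post x. r v) = 0" | "(LINT v|post x. r v) = p"
    | "0 < (LINT v|post x. r v)" "(LINT v|post x. r v) < p"
    using I0 I1 by linarith
  then show ?thesis
  proof cases
    case 1
    have "AE v in post x. r v = 0"
      using 1 integral_nonneg_eq_0_iff_AE[OF int] bounds by simp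
    then have "r v = 0" for v
      unfolding posterior_def by (rule continuous_AE_normal_zero[OF sigma_post_pos cont(1)])
    then have "r = (\<lambda>_. 0)" by (rule ext)
    then show ?thesis
      using x 1 by (simp add: no_rebate_profit_def)
  next
    case 2
    have "AE v in post x. p - r v = 0"
      using 2 d integral_nonneg_eq_0_iff_AE[where M="post x" and f="\<lambda>v. p - r v"] int bounds by simp
    then have "p - r v = 0" for v
      unfolding posterior_def by (rule continuous_AE_normal_zero[OF sigma_post_pos cont(2)])
    then have "r v = p" for v
      by (metis eq_iff_diff_eq_0)
    then have "profit x r = 0"
      unfolding expected_profit_def by simp
    then show ?thesis
      using no_rebate_profit_nonneg by simp
  next
    case 3
    then obtain m where m: "H m = (LINT v|post x. r v)"
      using H_surj by blast
    then have xm: "x = cutoff m"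
      using x by (simp add: cutoff_def)
    have "(LINT v|post x. r v) = (LINT v|post x. R (lower m) v)"
      unfolding xm integral_R_lower m[unfolded xm] ..
    from R_optimal_for_cutoff[OF r this] show ?thesis
      using xm unfolding J_def by blast
  qed
qed

subsection \<open>Maximising over the ramps\<close>

lemma cutoff_pos: "0 < cutoff m" and cutoff_less_price: "cutoff m < p"
  using H_pos[of m] H_less_price[of m] by (auto simp: cutoff_def)

lemma lower_eq: "lower m = \<tau> * cutoff m + (1 - \<tau>) * \<theta> - m"
  by (simp add: lower_def mu_post_def)

text \<open>Since the cutoff stays between 0 and \<open>p\<close>, \<open>lower m\<close> differs
  from \<open>- m\<close> by a bounded amount. This decides where the ramp goes as \<open>m\<close>
  tends to either infinity.\<close>

lemma lower_bounds: "(1 - \<tau>) * \<theta> - m \<le> lower m" "lower m \<le> \<tau> * p + (1 - \<tau>) * \<theta> - m"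
  using cutoff_pos[of m] cutoff_less_price[of m] tau_pos
  by (auto simp: lower_eq)

section \<open>Limits of the profit along the curve of ramps\<close>

lemma R_eventually_price: "\<forall>\<^sub>F m in at_bot. R (lower m) v = p"
proof (rule eventually_mono[OF eventually_le_at_bot[of "(1 - \<tau>) * \<theta> - v - 1"]])
  fix m assume "m \<le> (1 - \<tau>) * \<theta> - v - 1"
  then have "v < lower m" using lower_bounds(1)[of m] by linarith
  then show "R (lower m) v = p" by (simp add: R_def rc_program_def)
qed

lemma R_eq_0: "a + \<tau> * p \<le> v \<Longrightarrow> R a v = 0"
  using mult_pos_pos[OF tau_pos price_pos] by (auto simp: R_def rc_program_def)

lemma R_eventually_zero: "\<forall>\<^sub>F m in at_top. R (lower m) v = 0"
proof (rule eventually_mono[OF eventually_ge_at_top[of "2 * (\<tau> * p) + (1 - \<tau>) * \<theta> - v"]])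
  fix m assume "2 * (\<tau> * p) + (1 - \<tau>) * \<theta> - v \<le> m"
  then show "R (lower m) v = 0" using lower_bounds(2)[of m] by (intro R_eq_0) linarith
qed

lemma profit_integrand_bound: "\<bar>(p - R a v) * \<Phi> y\<bar> \<le> p"
proof -
  have "\<bar>p - R a v\<bar> * \<bar>\<Phi> y\<bar> \<le> p * 1"
    using R_nonneg[of a v] R_le[of a v] Phi_nonneg[of y] Phi_le_1[of y] by (intro mult_mono) auto
  then show ?thesis by (simp add: abs_mult)
qed

lemma J_tendsto_at_bot: "(J \<longlongrightarrow> 0) at_bot"
proof -
  interpret prob_space prior by (rule prob_space_prior)
  have "((\<lambda>m. LINT v|prior. (p - R (lower (- m)) v) * \<Phi> ((v - cutoff (- m)) / \<sigma>\<^sub>\<epsilon>)) \<longlongrightarrow> (LINT v|prior. 0)) at_top"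
  proof (rule integral_dominated_convergence_at_top[where w="\<lambda>_. p"])
    have "((\<lambda>m. (p - R (lower (- m)) v) * \<Phi> ((v - cutoff (- m)) / \<sigma>\<^sub>\<epsilon>)) \<longlongrightarrow> 0) at_top" for v
    proof (rule tendsto_eventually)
      show "\<forall>\<^sub>F m in at_top. (p - R (lower (- m)) v) * \<Phi> ((v - cutoff (- m)) / \<sigma>\<^sub>\<epsilon>) = 0"
        using R_eventually_price[of v] unfolding at_bot_mirror eventually_filtermap
        by eventually_elim simp
    qed
    then show "AE v in prior. ((\<lambda>m. (p - R (lower (- m)) v) * \<Phi> ((v - cutoff (- m)) / \<sigma>\<^sub>\<epsilon>)) \<longlongrightarrow> 0) at_top"
      by simp
  qed (auto simp: profit_integrand_bound)
  then show ?thesis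
    by (simp add: filterlim_at_bot_mirror J_def expected_profit_def)
qed

lemma J_tendsto_at_top: "(J \<longlongrightarrow> no_rebate_profit) at_top"
proof -
  interpret prob_space prior by (rule prob_space_prior)
  have c: "(cutoff \<longlongrightarrow> p) at_top"
    unfolding cutoff_def[abs_def] using H_tendsto_at_top by (auto intro!: tendsto_eq_intros)
  have "((\<lambda>m. LINT v|prior. (p - R (lower m) v) * \<Phi> ((v - cutoff m) / \<sigma>\<^sub>\<epsilon>))
      \<longlongrightarrow> (LINT v|prior. (p - 0) * \<Phi> ((v - p) / \<sigma>\<^sub>\<epsilon>))) at_top"
  proof (rule integral_dominated_convergence_at_top[where w="\<lambda>_. p"])
    have "((\<lambda>m. (p - R (lower m) v) * \<Phi> ((v - cutoff m) / \<sigma>\<^sub>\<epsilon>)) \<longlongrightarrow> (p - 0) * \<Phi> ((v - p) / \<sigma>\<^sub>\<epsilon>)) at_top" for v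
    proof (intro tendsto_mult tendsto_diff tendsto_const)
      show "((\<lambda>m. R (lower m) v) \<longlongrightarrow> 0) at_top"
        by (rule tendsto_eventually[OF R_eventually_zero])
      show "((\<lambda>m. \<Phi> ((v - cutoff m) / \<sigma>\<^sub>\<epsilon>)) \<longlongrightarrow> \<Phi> ((v - p) / \<sigma>\<^sub>\<epsilon>)) at_top"
        by (rule isCont_tendsto_compose[OF isCont_Phi])
           (use sd_noise_pos in \<open>intro tendsto_intros c; simp\<close>)
    qed
    then show "AE v in prior. ((\<lambda>m. (p - R (lower m) v) * \<Phi> ((v - cutoff m) / \<sigma>\<^sub>\<epsilon>))
        \<longlongrightarrow> (p - 0) * \<Phi> ((v - p) / \<sigma>\<^sub>\<epsilon>)) at_top"
      by simp
  qed (auto simp: profit_integrand_bound)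
  then show ?thesis
    by (simp add: J_def[abs_def] no_rebate_profit_def expected_profit_def)
qed

lemma J_exceeds_no_rebate_profit: "\<exists>m. no_rebate_profit < J m"
proof -
  interpret prob_space prior by (rule prob_space_prior)
  \<comment> \<open>For every cutoff \<open>c\<close> between 0 and \<open>p\<close> one has
    \<open>\<bar>v - c\<bar> \<le> \<bar>v\<bar> + p\<close>, so \<open>g\<close> bounds the density
    below at all such cutoffs. Being independent of \<open>m\<close>, it yields a gain rate
    \<open>q\<close> fixed before \<open>m\<close> is chosen.\<close>
  define g where "g v = \<phi> ((\<bar>v\<bar> + p) / \<sigma>\<^sub>\<epsilon>)" for v
  have [measurable]: "g \<in> borel_measurable borel" unfolding g_def by measurable
  have int_g: "integrable prior g"
    by (rule integrable_bounded_normal[OF sd_prior_pos, where B=1]) (auto simp: g_def phi_le_1)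
  define q where "q = (LINT v|prior. g v)"
  have "(LINT v|prior. 0) < q"
    unfolding q_def using int_g emeasure_space_1 by (intro integral_less_AE_space) (auto simp: g_def phi_pos)
  then have q: "0 < q" by simp
  \<comment> \<open>Half of the gain per unit of \<open>H m\<close>, which is at least
    \<open>p * q / \<sigma>\<^sub>\<epsilon>\<close>; the loss per unit will be at most
    \<open>e\<close>.\<close>
  define e where "e = p * q / (2 * \<sigma>\<^sub>\<epsilon>)"
  have e: "0 < e" using q price_pos sd_noise_pos by (simp add: e_def)
  \<comment> \<open>With this \<open>m\<close> the ramp ends at or below
    \<open>- \<sigma>\<^sub>\<epsilon> / e\<close>. As the cutoff is positive,
    \<open>Phi_le_small_phi\<close> applies wherever a rebate is paid.\<close>
  define m where "m = 2 * (\<tau> * p) + (1 - \<tau>) * \<theta> + \<sigma>\<^sub>\<epsilon> / e"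
  let ?c = "cutoff m" and ?R = "R (lower m)"
  have int: "integrable prior (\<lambda>v. (p - ?R v) * \<Phi> ((v - ?c) / \<sigma>\<^sub>\<epsilon>))"
    "integrable prior (\<lambda>v. p * \<Phi> ((v - p) / \<sigma>\<^sub>\<epsilon>))"
    "integrable prior (\<lambda>v. ?R v * \<phi> ((v - ?c) / \<sigma>\<^sub>\<epsilon>))"
    using R_nonneg R_le price_pos
    by (intro integrable_times_Phi[where B=p] integrable_times_phi[where B=p]; simp add: abs_R_le)+
  have loss: "?R v * \<Phi> ((v - ?c) / \<sigma>\<^sub>\<epsilon>) \<le> e * (?R v * \<phi> ((v - ?c) / \<sigma>\<^sub>\<epsilon>))" for v
  proof (cases "lower m + \<tau> * p \<le> v")
    case False
    have "v - ?c \<le> - (\<sigma>\<^sub>\<epsilon> / e)"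
      using False lower_bounds(2)[of m] cutoff_pos[of m] m_def by linarith
    then have "(v - ?c) / \<sigma>\<^sub>\<epsilon> \<le> - 1 / e"
      using sd_noise_pos e by (simp add: field_simps)
    from mult_left_mono[OF Phi_le_small_phi[OF e this] R_nonneg[of "lower m" v]] show ?thesis
      by (simp add: mult_ac)
  qed (simp add: R_eq_0)
  have gain: "H m / \<sigma>\<^sub>\<epsilon> * g v \<le> \<Phi> ((v - ?c) / \<sigma>\<^sub>\<epsilon>) - \<Phi> ((v - p) / \<sigma>\<^sub>\<epsilon>)" for v
  proof -
    have "((v - ?c) / \<sigma>\<^sub>\<epsilon> - (v - p) / \<sigma>\<^sub>\<epsilon>) * g v \<le> \<Phi> ((v - ?c) / \<sigma>\<^sub>\<epsilon>) - \<Phi> ((v - p) / \<sigma>\<^sub>\<epsilon>)"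
      unfolding g_def using cutoff_pos[of m] cutoff_less_price[of m] sd_noise_pos
      by (intro Phi_increment_lower_bound) (auto simp: abs_divide intro!: divide_right_mono)
    moreover have "(v - ?c) / \<sigma>\<^sub>\<epsilon> - (v - p) / \<sigma>\<^sub>\<epsilon> = H m / \<sigma>\<^sub>\<epsilon>"
      by (simp add: cutoff_def flip: diff_divide_distrib)
    ultimately show ?thesis by simp
  qed
  have "H m * (p * q / \<sigma>\<^sub>\<epsilon> - e) \<le> p * (H m / \<sigma>\<^sub>\<epsilon>) * q - e * (LINT v|prior. ?R v * \<phi> ((v - ?c) / \<sigma>\<^sub>\<epsilon>))"
  proof -
    \<comment> \<open>By Bayes' rule this weighted rebate is a multiple of the posterior mean
      \<open>H m\<close>, with a factor at most 1.\<close>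
    have "(LINT v|prior. ?R v * \<phi> ((v - ?c) / \<sigma>\<^sub>\<epsilon>)) = \<sigma>\<^sub>\<epsilon> / \<sigma> * \<phi> ((\<theta> - ?c) / \<sigma>) * H m"
      by (subst integral_times_phi) (auto simp: integral_R_lower)
    also have "\<dots> \<le> 1 * 1 * H m"
      using noise_le_sigma sigma_pos sd_noise_pos phi_le_1 H_nonneg by (intro mult_mono) auto
    finally show ?thesis
      using mult_left_mono[of _ "H m" e] e by (simp add: algebra_simps)
  qed
  also have "\<dots> = (LINT v|prior. p * (H m / \<sigma>\<^sub>\<epsilon>) * g v - e * (?R v * \<phi> ((v - ?c) / \<sigma>\<^sub>\<epsilon>)))"
    using int(3) int_g by (simp add: q_def)
  also have "\<dots> \<le> (LINT v|prior. (p - ?R v) * \<Phi> ((v - ?c) / \<sigma>\<^sub>\<epsilon>) - p * \<Phi> ((v - p) / \<sigma>\<^sub>\<epsilon>))"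
  proof (rule integral_mono)
    show "p * (H m / \<sigma>\<^sub>\<epsilon>) * g v - e * (?R v * \<phi> ((v - ?c) / \<sigma>\<^sub>\<epsilon>))
        \<le> (p - ?R v) * \<Phi> ((v - ?c) / \<sigma>\<^sub>\<epsilon>) - p * \<Phi> ((v - p) / \<sigma>\<^sub>\<epsilon>)" for v
      using mult_left_mono[OF gain[of v], of p] loss[of v] price_pos
      by (simp add: left_diff_distrib right_diff_distrib mult.assoc)
  qed (use int int_g in auto)
  also have "\<dots> = J m - no_rebate_profit"
    using int by (simp add: J_def no_rebate_profit_def expected_profit_def)
  finally have "H m * (p * q / \<sigma>\<^sub>\<epsilon> - e) \<le> J m - no_rebate_profit" .
  moreover have "0 < H m * (p * q / \<sigma>\<^sub>\<epsilon> - e)"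
    using e H_pos[of m] by (intro mult_pos_pos) (simp_all add: e_def)
  ultimately show ?thesis by (intro exI[of _ m]) linarith
qed

section \<open>The first-order condition\<close>

text \<open>\<open>slope_mass m / \<tau>\<close> is the derivative of the expected rebate cost in \<open>v\<^sub>L\<close> at fixed cutoff.\<close>

definition slope_mass :: "real \<Rightarrow> real" where
  "slope_mass m = (LINT v|prior. indicator {lower m<..<lower m + \<tau> * p} v * \<Phi> ((v - cutoff m) / \<sigma>\<^sub>\<epsilon>))"

lemma slope_mass_eq:
  "slope_mass m = (LBINT w=lower m..lower m + \<tau> * p.
     \<Phi> ((w - cutoff m) / \<sigma>\<^sub>\<epsilon>) * (1 / \<sigma>\<^sub>\<theta>) * \<phi> ((\<theta> - w) / \<sigma>\<^sub>\<theta>))"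
proof -
  have "lower m \<le> lower m + \<tau> * p"
    using tau_pos price_pos by simp
  then have "(LBINT w=lower m..lower m + \<tau> * p. \<Phi> ((w - cutoff m) / \<sigma>\<^sub>\<epsilon>) * (1 / \<sigma>\<^sub>\<theta>) * \<phi> ((\<theta> - w) / \<sigma>\<^sub>\<theta>))
    = (LINT w|lborel. indicator {lower m<..<lower m + \<tau> * p} w *
        (\<Phi> ((w - cutoff m) / \<sigma>\<^sub>\<epsilon>) * (1 / \<sigma>\<^sub>\<theta>) * \<phi> ((\<theta> - w) / \<sigma>\<^sub>\<theta>)))"
    by (simp add: interval_lebesgue_integral_def set_lebesgue_integral_def)
  also have "\<dots> = (LINT w|lborel. normal_density \<theta> \<sigma>\<^sub>\<theta> w *
      (indicator {lower m<..<lower m + \<tau> * p} w * \<Phi> ((w - cutoff m) / \<sigma>\<^sub>\<epsilon>)))"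
  proof -
    have "\<phi> ((\<theta> - w) / \<sigma>\<^sub>\<theta>) = \<phi> ((w - \<theta>) / \<sigma>\<^sub>\<theta>)" for w
      by (simp add: std_normal_density_def power_divide power2_commute)
    then show ?thesis
      by (simp add: normal_density_affine_std[OF sd_prior_pos] mult_ac)
  qed
  also have "\<dots> = slope_mass m"
    unfolding slope_mass_def by (subst integral_density) auto
  finally show ?thesis ..
qed

lemma has_real_derivative_cutoff: "(cutoff has_real_derivative P m / \<tau>) (at m)"
  unfolding cutoff_def[abs_def] by (rule derivative_eq_intros has_real_derivative_H refl | simp)+

lemma has_real_derivative_lower: "(lower has_real_derivative P m - 1) (at m)"
  unfolding lower_eq[abs_def]
  by (rule derivative_eq_intros has_real_derivative_cutoff refl | use tau_pos in simp)+

lemma cutoff_lipschitz: "\<bar>cutoff m - cutoff n\<bar> \<le> \<bar>m - n\<bar> / \<tau>"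
  using H_lipschitz[of n m] by (simp add: cutoff_def abs_minus_commute)

lemma lower_lipschitz: "\<bar>lower m - lower n\<bar> \<le> 2 * \<bar>m - n\<bar>"
proof -
  have "lower m - lower n = \<tau> * (cutoff m - cutoff n) - (m - n)"
    by (simp add: lower_eq algebra_simps)
  also have "\<bar>\<dots>\<bar> \<le> \<tau> * \<bar>cutoff m - cutoff n\<bar> + \<bar>m - n\<bar>"
    using tau_pos abs_triangle_ineq4[of "\<tau> * (cutoff m - cutoff n)" "m - n"] by (simp add: abs_mult)
  also have "\<dots> \<le> \<bar>m - n\<bar> + \<bar>m - n\<bar>"
    using mult_left_mono[OF cutoff_lipschitz[of m n], of \<tau>] tau_pos by simp
  finally show ?thesis by simp
qed

lemma R_shift: "R a v = R 0 (v - a)"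
  by (simp add: R_eq_clamp)

text \<open>Raising \<open>m\<close> moves the ramp at rate \<open>P m - 1\<close>, which changes
  the rebate cost on its slope, and the cutoff at rate \<open>P m / \<tau>\<close>, which changes
  demand. The two effects are the two terms of the derivative.\<close>

lemma has_real_derivative_J:
  "(J has_real_derivative
     ((1 - P m) * slope_mass m - P m * (cutoff m * (1 / \<sigma>) * \<phi> ((\<theta> - cutoff m) / \<sigma>))) / \<tau>) (at m)"
proof -
  interpret prob_space prior by (rule prob_space_prior)
  let ?h = "\<lambda>m v. (p - R (lower m) v) * \<Phi> ((v - cutoff m) / \<sigma>\<^sub>\<epsilon>)"
  let ?i = "\<lambda>v. indicator {lower m<..<lower m + \<tau> * p} v * \<Phi> ((v - cutoff m) / \<sigma>\<^sub>\<epsilon>)"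
  let ?j = "\<lambda>v. (p - R (lower m) v) * (\<phi> ((v - cutoff m) / \<sigma>\<^sub>\<epsilon>) / \<sigma>\<^sub>\<epsilon>)"
  let ?d = "\<lambda>v. (1 - P m) / \<tau> * ?i v - P m / \<tau> * ?j v"
  have bd: "\<bar>p - R a v\<bar> \<le> p" for a v
    using R_nonneg[of a v] R_le[of a v] by auto
  have lip: "\<bar>?h s v - ?h t v\<bar> \<le> (2 / \<tau> + p / (\<sigma>\<^sub>\<epsilon> * \<tau>)) * \<bar>s - t\<bar>" for s t v
  proof -
    let ?y = "\<lambda>m. (v - cutoff m) / \<sigma>\<^sub>\<epsilon>"
    have dR: "\<bar>R (lower s) v - R (lower t) v\<bar> \<le> 2 / \<tau> * \<bar>s - t\<bar>"
    proof -
      have "\<bar>R (lower s) v - R (lower t) v\<bar> \<le> \<bar>lower s - lower t\<bar> / \<tau>"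
        using R_lipschitz[of "lower s" v "lower t" v] by (simp add: abs_minus_commute)
      also have "\<dots> \<le> 2 * \<bar>s - t\<bar> / \<tau>"
        using lower_lipschitz tau_pos by (intro divide_right_mono) auto
      finally show ?thesis by simp
    qed
    have dPhi: "\<bar>\<Phi> (?y s) - \<Phi> (?y t)\<bar> \<le> 1 / (\<sigma>\<^sub>\<epsilon> * \<tau>) * \<bar>s - t\<bar>"
    proof -
      have "\<bar>\<Phi> (?y s) - \<Phi> (?y t)\<bar> \<le> \<bar>cutoff s - cutoff t\<bar> / \<sigma>\<^sub>\<epsilon>"
        using Phi_lipschitz[of "?y s" "?y t"] sd_noise_pos
        by (simp add: abs_minus_commute flip: diff_divide_distrib)
      also have "\<dots> \<le> \<bar>s - t\<bar> / \<tau> / \<sigma>\<^sub>\<epsilon>"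
        using cutoff_lipschitz sd_noise_pos by (intro divide_right_mono) auto
      finally show ?thesis by (simp add: mult.commute)
    qed
    \<comment> \<open>The increment of the product is split into the change of the rebate and the
      change of demand.\<close>
    define A where "A = - (R (lower s) v - R (lower t) v) * \<Phi> (?y s)"
    define B where "B = (p - R (lower t) v) * (\<Phi> (?y s) - \<Phi> (?y t))"
    have "\<bar>A\<bar> \<le> 2 / \<tau> * \<bar>s - t\<bar> * 1"
      unfolding A_def abs_mult abs_minus_cancel using dR Phi_nonneg Phi_le_1 tau_pos
      by (intro mult_mono) auto
    moreover have "\<bar>B\<bar> \<le> p * (1 / (\<sigma>\<^sub>\<epsilon> * \<tau>) * \<bar>s - t\<bar>)"
      unfolding B_def abs_mult using dPhi bd price_pos by (intro mult_mono) auto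
    moreover have "?h s v - ?h t v = A + B"
      unfolding A_def B_def by (simp add: algebra_simps)
    ultimately have "\<bar>?h s v - ?h t v\<bar> \<le> 2 / \<tau> * \<bar>s - t\<bar> + p * (1 / (\<sigma>\<^sub>\<epsilon> * \<tau>) * \<bar>s - t\<bar>)"
      using abs_triangle_ineq[of A B] by linarith
    then show ?thesis by (simp add: distrib_right)
  qed
  have der: "((\<lambda>m. ?h m v) has_real_derivative ?d v) (at m)"
    if "v \<noteq> lower m" "v \<noteq> lower m + \<tau> * p" for v
  proof -
    let ?r = "if v \<in> {lower m<..<lower m + \<tau> * p} then - 1 / \<tau> else 0"
    have "(R 0 has_real_derivative ?r) (at (v - lower m))"
      using has_real_derivative_R[of "v - lower m" 0] that by (auto cong: if_cong simp: algebra_simps)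
    moreover have "((\<lambda>m. v - lower m) has_real_derivative 1 - P m) (at m)"
      by (rule derivative_eq_intros has_real_derivative_lower refl | simp)+
    ultimately have dR: "((\<lambda>m. R (lower m) v) has_real_derivative ?r * (1 - P m)) (at m)"
      unfolding R_shift[of "lower _"] by (rule DERIV_chain2)
    have "((\<lambda>m. (v - cutoff m) / \<sigma>\<^sub>\<epsilon>) has_real_derivative - (P m / \<tau>) / \<sigma>\<^sub>\<epsilon>) (at m)"
      by (rule derivative_eq_intros has_real_derivative_cutoff refl | use sd_noise_pos in simp)+
    then have "((\<lambda>m. \<Phi> ((v - cutoff m) / \<sigma>\<^sub>\<epsilon>)) has_real_derivative \<phi> ((v - cutoff m) / \<sigma>\<^sub>\<epsilon>) * (- (P m / \<tau>) / \<sigma>\<^sub>\<epsilon>)) (at m)"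
      by (rule DERIV_chain2[OF has_real_derivative_Phi])
    from DERIV_mult[OF DERIV_diff[OF DERIV_const dR] this] show ?thesis
      by (rule DERIV_cong)
        (simp add: diff_divide_distrib left_diff_distrib right_diff_distrib mult_ac)
  qed
  have "AE v in lborel. v \<noteq> lower m" "AE v in lborel. v \<noteq> lower m + \<tau> * p"
    by (rule AE_lborel_singleton)+
  then have "AE v in lborel. ((\<lambda>m. ?h m v) has_real_derivative ?d v) (at m)"
    by eventually_elim (rule der)
  then have "((\<lambda>m. LINT v|prior. ?h m v) has_real_derivative (LINT v|prior. ?d v)) (at m)"
    by (intro has_real_derivative_integral_lipschitz[OF finite_measure_axioms _ lip])
       (auto simp: AE_normal_iff_AE_lborel[OF sd_prior_pos] intro!: integrable_times_Phi[where B=p] bd)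
  moreover have "(LINT v|prior. ?d v)
    = ((1 - P m) * slope_mass m - P m * (cutoff m * (1 / \<sigma>) * \<phi> ((\<theta> - cutoff m) / \<sigma>))) / \<tau>"
  proof -
    interpret post: prob_space "post (cutoff m)" by (rule prob_space_post)
    have "integrable (post (cutoff m)) (R (lower m))"
      unfolding posterior_def by (rule integrable_R[OF sigma_post_pos])
    \<comment> \<open>Indifference says that the marginal consumer pays \<open>cutoff m\<close> net
      of the expected rebate; this is the origin of the factor \<open>c\<close> in the first
      equation of the system.\<close>
    then have "(LINT v|post (cutoff m). p - R (lower m) v) = cutoff m"
      using post.prob_space by (simp add: integral_R_lower) (simp add: cutoff_def)
    then have j: "(LINT v|prior. ?j v) = \<phi> ((\<theta> - cutoff m) / \<sigma>) / \<sigma> * cutoff m"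
      by (simp only: integral_posterior measurable_R borel_measurable_diff borel_measurable_const)
    have "integrable prior ?i"
      by (rule integrable_times_Phi[where B=1]) (auto simp: indicator_def)
    moreover have "integrable prior ?j"
      using integrable_times_phi[of "\<lambda>v. p - R (lower m) v" p "cutoff m"] bd by simp
    ultimately have "(LINT v|prior. ?d v) = (1 - P m) / \<tau> * (LINT v|prior. ?i v) - P m / \<tau> * (LINT v|prior. ?j v)"
      by (subst Bochner_Integration.integral_diff) (auto simp only: integral_mult_right_zero integrable_mult_right)
    also have "\<dots> = ((1 - P m) * slope_mass m - P m * (cutoff m * (1 / \<sigma>) * \<phi> ((\<theta> - cutoff m) / \<sigma>))) / \<tau>"
      unfolding j slope_mass_def[symmetric] by (simp add: divide_inverse algebra_simps)
    finally show ?thesis .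
  qed
  ultimately show ?thesis
    by (simp add: J_def[abs_def] expected_profit_def)
qed

section \<open>Existence and characterisation of the optimum\<close>

lemma J_attains_max: "\<exists>m. \<forall>n. J n \<le> J m"
proof -
  obtain t where t: "no_rebate_profit < J t"
    using J_exceeds_no_rebate_profit by blast
  have "continuous_on UNIV J"
    using has_real_derivative_J by (intro continuous_at_imp_continuous_on) (blast intro: DERIV_isCont)
  then show ?thesis
    using J_tendsto_at_bot J_tendsto_at_top _ t
    by (rule continuous_attains_sup_real) (use t no_rebate_profit_nonneg in linarith)
qed

text \<open>The first equation is \<open>J' = 0\<close> divided by \<open>P m\<close> and
  \<open>1 - P m\<close>, both positive. The second holds by the choice of the right end, and the
  third is the definition of \<open>cutoff\<close> with \<Psi> written out.\<close>

lemma rc_system_stationary: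
  assumes "\<forall>n. J n \<le> J m"
  shows "rc_system \<theta> \<sigma>\<^sub>\<theta> \<sigma>\<^sub>\<epsilon> p (cutoff m) (lower m) (lower m + \<tau> * p)"
proof -
  have "((1 - P m) * slope_mass m - P m * (cutoff m * (1 / \<sigma>) * \<phi> ((\<theta> - cutoff m) / \<sigma>))) / \<tau> = 0"
    by (rule DERIV_local_max[OF has_real_derivative_J, of 1]) (use assms in auto)
  then have foc: "(1 - P m) * slope_mass m = P m * (cutoff m * (1 / \<sigma>) * \<phi> ((\<theta> - cutoff m) / \<sigma>))"
    using tau_pos by simp
  have xs: "(lower m - \<mu> (cutoff m)) / \<sigma>\<^sub>v = - m / \<sigma>\<^sub>v"
    "(lower m + \<tau> * p - \<mu> (cutoff m)) / \<sigma>\<^sub>v = (\<tau> * p - m) / \<sigma>\<^sub>v"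
    by (simp_all add: lower_def)
  have "slope_mass m / P m = cutoff m * (1 / \<sigma>) * \<phi> ((\<theta> - cutoff m) / \<sigma>) / (1 - P m)"
    using P_pos[of m] P_less_1[of m] foc by (subst frac_eq_eq) (auto simp only: mult.commute)
  moreover have "\<Phi> ((\<tau> * p - m) / \<sigma>\<^sub>v) - \<Phi> (- m / \<sigma>\<^sub>v) = P m"
    "1 + \<Phi> (- m / \<sigma>\<^sub>v) - \<Phi> ((\<tau> * p - m) / \<sigma>\<^sub>v) = 1 - P m"
    by (simp_all add: P_def)
  moreover have "p = cutoff m + \<sigma>\<^sub>v / \<tau> * (x * \<Phi> x - y * \<Phi> y + \<phi> x - \<phi> y)"
    if "x = (\<tau> * p - m) / \<sigma>\<^sub>v" "y = - m / \<sigma>\<^sub>v" for x y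
  proof -
    have "x * \<Phi> x - y * \<Phi> y + \<phi> x - \<phi> y = \<Psi> x - \<Psi> y"
      by (simp add: \<Psi>_def)
    then show ?thesis
      by (simp only: that cutoff_def H_def)
  qed
  ultimately show ?thesis
    unfolding rc_system_def Let_def xs slope_mass_eq[symmetric] by simp
qed

text \<open>Some ramp strictly beats the profit without rebates, which rules out the second
  alternative of \<open>feasible_cases\<close> for an optimum. The equality clause of the first
  alternative then identifies the program as a ramp.\<close>

lemma optimal_iff:
  "optimal \<theta> \<sigma>\<^sub>\<theta> \<sigma>\<^sub>\<epsilon> p x r \<longleftrightarrow> (\<exists>m. x = cutoff m \<and> r = R (lower m) \<and> (\<forall>n. J n \<le> J m))"
proof
  assume opt: "optimal \<theta> \<sigma>\<^sub>\<theta> \<sigma>\<^sub>\<epsilon> p x r"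
  then have feas: "feasible \<theta> \<sigma>\<^sub>\<theta> \<sigma>\<^sub>\<epsilon> p x r" and J: "J n \<le> profit x r" for n
    using feasible_R by (auto simp: optimal_def is_arg_max_linorder J_def)
  obtain t where "no_rebate_profit < J t"
    using J_exceeds_no_rebate_profit by blast
  then have "\<not> profit x r \<le> no_rebate_profit"
    using J[of t] by linarith
  then obtain m where m: "x = cutoff m" "profit x r \<le> J m" "profit x r = J m \<longrightarrow> r = R (lower m)"
    using feasible_cases[OF feas] by blast
  then have "profit x r = J m" using J[of m] by linarith
  then show "\<exists>m. x = cutoff m \<and> r = R (lower m) \<and> (\<forall>n. J n \<le> J m)"
    using m J by auto
next
  assume "\<exists>m. x = cutoff m \<and> r = R (lower m) \<and> (\<forall>n. J n \<le> J m)"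
  then obtain m where m: "x = cutoff m" "r = R (lower m)" "\<And>n. J n \<le> J m"
    by blast
  obtain t where "no_rebate_profit < J t"
    using J_exceeds_no_rebate_profit by blast
  then have "profit y s \<le> J m" if "feasible \<theta> \<sigma>\<^sub>\<theta> \<sigma>\<^sub>\<epsilon> p y s" for y s
    using feasible_cases[OF that] m(3) by (meson less_imp_le order_trans)
  then show "optimal \<theta> \<sigma>\<^sub>\<theta> \<sigma>\<^sub>\<epsilon> p x r"
    using feasible_R m by (auto simp: optimal_def is_arg_max_linorder J_def)
qed

end

theorem theorem4:
  fixes \<theta> \<sigma>\<^sub>\<theta> \<sigma>\<^sub>\<epsilon> p :: real
  assumes "\<sigma>\<^sub>\<theta> > 0" and "\<sigma>\<^sub>\<epsilon> > 0"
    and "market_price \<theta> \<sigma>\<^sub>\<theta> \<sigma>\<^sub>\<epsilon> p"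
  shows "(\<exists>c r. optimal \<theta> \<sigma>\<^sub>\<theta> \<sigma>\<^sub>\<epsilon> p c r) \<and>
         (\<forall>c r. optimal \<theta> \<sigma>\<^sub>\<theta> \<sigma>\<^sub>\<epsilon> p c r \<longrightarrow>
            (\<exists>v\<^sub>L v\<^sub>H. rc_system \<theta> \<sigma>\<^sub>\<theta> \<sigma>\<^sub>\<epsilon> p c v\<^sub>L v\<^sub>H \<and>
                     r = rc_program (tau \<sigma>\<^sub>\<theta> \<sigma>\<^sub>\<epsilon>) p v\<^sub>L v\<^sub>H))"
proof -
  interpret rebate_problem \<theta> \<sigma>\<^sub>\<theta> \<sigma>\<^sub>\<epsilon> p
    using assms by unfold_locales (auto simp: market_price_def is_arg_max_linorder)
  show ?thesis
    using J_attains_max rc_system_stationary unfolding optimal_iff R_def by blast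
qed

end
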